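(* Consider the two-dimensional FD-DG semidiscretization consisting of the finite difference scheme in $\Omega_1$, \begin{align*} \mathbf{w}_{tt}=b_1\mathcal{D}\mathbf{w}&+\mathcal{H}^{-1}\Big[\tfrac12b_1\mathbf{d}_\Gamma H(\mathbf{w}_\Gamma-P^g_{u2w}\mathbf{u}_\Gamma)-\tfrac12\mathbf{e}_\Gamma H(b_1\mathbf{d}_\Gamma^T\mathbf{w}+P^b_{u2w}b_2\mathbf{u}_{\Gamma y})\Big]\\ &-\mathcal{H}^{-1}\Big[\tfrac{b_1\tau_w}{h_1}\mathbf{e}_\Gamma H(\mathbf{w}_\Gamma-P^g_{u2w}\mathbf{u}_\Gamma)+\tfrac{b_2\sigma_w}{h_2}\mathbf{e}_\Gamma HP^b_{u2w}(P^g_{w2u}\mathbf{w}_\Gamma-\mathbf{u}_\Gamma)\Big], \end{align*} and the discontinuous Galerkin scheme in $\Omega_2$: for each $t\in(0,T]$, find $u\in V_q$ such that for all $\phi\in V_q$ \begin{align*} (u_{tt},\phi)_{\Omega_2}=-(b_2\nabla u,\nabla\phi)_{\Omega_2}&+\sum_{F\in\mathcal{F}^\Gamma}\Big[\tfrac12b_2(u-w_F,\nabla\phi\cdot\mathbf{n})_F+\tfrac12(b_2\nabla u\cdot\mathbf{n}-b_1w_F^\nabla,\phi)_F\Big]\\ &-\sum_{F\in\mathcal{F}^\Gamma}\Big[\tfrac{\tau_u}{h_2}b_2(u-w_F,\phi)_F+\tfrac{\sigma_u}{h_1}b_1(\tilde{\tilde u}-\tilde w,\phi)_F\Big]. \end{align*}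 If $\tau_w=\sigma_u\ge\frac1{4\beta}$ and $\tau_u=\sigma_w\ge\frac1{C_{tr}}$, where the constants $\beta$ and $C_{tr}$ are independent of the mesh sizes, then the semidiscretization is stable.
   Context: Continuous problem: $U_{tt}=\nabla\cdot b\nabla U$ in $\Omega=\Omega_1\cup\Omega_2$, $t\in(0,T]$, $\Omega_1=[0,1]\times[0,1]$, $\Omega_2=[0,1]\times[-1,0]$, interface $\Gamma=\Omega_1\cap\Omega_2$, $b=b_i$ in $\Omega_i$ with positive constants $b_1\ne b_2$, and interface conditions of continuity of $U$ and of $bU_y$ across $\Gamma$. Contributions from the outer boundary $\partial\Omega$ are not considered. FD side ($\Omega_1$): a Cartesian grid with $n$ points per direction and spacing $h_1$; $\mathbf{w}$ is the vector of values $w_{ij}\approx U(x_i,y_j)$ ordered with $j$ running fastest. $D=H^{-1}(-A+\mathbf{e}_n\mathbf{d}_n^T-\mathbf{e}_1\mathbf{d}_1^T)$ is a one-dimensional summation-by-parts (SBP) second derivative operator: $H$ symmetric positive definite (diagonal), $A$ symmetric positive semidefinite, $\mathbf{e}_1=[1,0,\dots,0]^T$, $\mathbf{e}_n=[0,\dots,0,1]^T$, and $\mathbf{d}_1^T,\mathbf{d}_n^T$ first derivative approximations at the first/last grid point. $\mathcal{D}=D\otimes I+I\otimes D$, $\mathcal{H}=H\otimes H$, $\mathbf{e}_\Gamma=I\otimes\mathbf{e}_1$, $\mathbf{d}_\Gamma=-I\otimes\mathbf{d}_1$, $\mathbf{w}_\Gamma=\mathbf{e}_\Gamma^T\mathbf{w}$.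 With outer boundary terms omitted, $\mathcal{H}\mathcal{D}=-A\otimes H-H\otimes A+\mathbf{e}_\Gamma H\mathbf{d}_\Gamma^T$. The borrowing capacity $\beta>0$ is the maximal $\beta$ such that $A-\beta h_1(\mathbf{d}_1\mathbf{d}_1^T+\mathbf{d}_n\mathbf{d}_n^T)$ is symmetric positive semidefinite; it does not depend on $h_1$. DG side ($\Omega_2$): $\mathcal{K}$ is a shape regular triangulation of $\Omega_2$ with mesh size $h_2$; $V_q=\{v: v|_K\in\mathcal{P}^q(K)\ \forall K\in\mathcal{K}\}$, with $\mathcal{P}^q(K)$ the polynomials of degree at most $q$; $\mathcal{F}^\Gamma$ is the set of faces $K\cap\Gamma$; $\mathbf{n}$ is the outward unit normal to $\Omega_2$ on $\Gamma$. $(\cdot,\cdot)_{\Omega_2}$ and $(\cdot,\cdot)_F$ are $L^2$ inner products. $\mathbf{u}_\Gamma$ and $\mathbf{u}_{\Gamma y}$ are the vectors of Lagrange coefficients on $\Gamma$ of $u$ and of $\nabla u\cdot\mathbf{n}=u_y$. $M$ is the symmetric positive definite DG mass matrix on $\Gamma$, so that $\sum_{F\in\mathcal{F}^\Gamma}(p,r)_F=\mathbf{p}^TM\mathbf{r}$ for piecewise polynomials with coefficient vectors $\mathbf{p},\mathbf{r}$. $C_{tr}>0$ is a constant such that $\|\nabla u\|^2_{\Omega_2}\ge C_{tr}h_2\|\nabla u\cdot\mathbf{n}\|^2_\Gamma$ for all $u\in V_q$ (a discrete trace inequality). Projection operators: $P^g_{u2w},P^b_{u2w}$ map DG coefficient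 vectors on $\Gamma$ to values at FD grid points on $\Gamma$, and $P^g_{w2u},P^b_{w2u}$ map FD grid values on $\Gamma$ to DG coefficient vectors. They form two norm compatible pairs: $$HP^g_{u2w}=(MP^b_{w2u})^T,\qquad HP^b_{u2w}=(MP^g_{w2u})^T.$$ With $\phi_j^F$ ($j=1,\dots,q+1$) the Lagrange basis functions on face $F$, define on $F$: $w_F=\sum_j(P^g_{w2u}\mathbf{w}_\Gamma)^F_j\phi^F_j$, $w_F^\nabla=\sum_j(P^b_{w2u}\mathbf{d}_\Gamma^T\mathbf{w})^F_j\phi_j^F$, $\tilde{\tilde u}=\sum_j(P^b_{w2u}P^g_{u2w}\mathbf{u}_\Gamma)^F_j\phi^F_j$, $\tilde w=\sum_j(P^b_{w2u}\mathbf{w}_\Gamma)_j^F\phi^F_j$. Stability means that the semidiscretization satisfies a discrete energy estimate: the quantity $$E=\mathbf{w}_t^T\mathcal{H}\mathbf{w}_t+(u_t,u_t)_{\Omega_2}-2\tilde E_1-2\tilde E_2$$ satisfies $\frac{d}{dt}E=0$ for all solutions, with $\tilde E_1\le0$ and $\tilde E_2\le0$, where \begin{align*} -2\tilde E_1&=b_1\mathbf{w}^T(A\otimes H+H\otimes A)\mathbf{w}+\tfrac{b_1\tau_w}{h_1}\mathbf{r}^TH\mathbf{r}-b_1(\mathbf{d}_\Gamma^T\mathbf{w})^TH\mathbf{r},\quad \mathbf{r}=\mathbf{w}_\Gamma-P^g_{u2w}\mathbf{u}_\Gamma,\\ -2\tilde E_2&=b_2\|\nabla u\|^2_{\Omega_2}+\tfrac{b_2\tau_u}{h_2}\mathbf{s}^TM\mathbf{s}-b_2\mathbf{s}^TM\mathbf{u}_{\Gamma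 y},\quad \mathbf{s}=\mathbf{u}_\Gamma-P^g_{w2u}\mathbf{w}_\Gamma. \end{align*} *)

theory Defs
  imports "HOL-Analysis.Analysis" "Jordan_Normal_Form.Gauss_Jordan_Elimination"
begin

no_notation inner (infix \<open>\<bullet>\<close> 70)
no_notation vec_nth (infixl \<open>$\<close> 90)

text \<open>From here on \<open>\<bullet>\<close> and \<open>$\<close> belong to the vectors of \<open>Jordan_Normal_Form\<close>; the Euclidean
  inner product is written \<open>inner\<close>. All indices start at 0.\<close>

section \<open>Matrices\<close>

definition kron :: "real mat \<Rightarrow> real mat \<Rightarrow> real mat" (infixl \<open>\<otimes>\<^sub>k\<close> 72) where
  "A \<otimes>\<^sub>k B = Matrix.mat (dim_row A * dim_row B) (dim_col A * dim_col B)
     (\<lambda>(i, j). A $$ (i div dim_row B, j div dim_col B) * B $$ (i mod dim_row B, j mod dim_col B))"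

definition col_mat :: "real Matrix.vec \<Rightarrow> real mat" where
  "col_mat v = mat_of_cols (dim_vec v) [v]"

abbreviation outer_prod :: "real Matrix.vec \<Rightarrow> real Matrix.vec \<Rightarrow> real mat" where
  "outer_prod u v \<equiv> col_mat u * transpose_mat (col_mat v)"

definition sym_psd :: "nat \<Rightarrow> real mat \<Rightarrow> bool" where
  "sym_psd n A \<longleftrightarrow> A \<in> carrier_mat n n \<and> transpose_mat A = A \<and>
     (\<forall>x \<in> carrier_vec n. 0 \<le> x \<bullet> (A *\<^sub>v x))"

definition sym_pd :: "nat \<Rightarrow> real mat \<Rightarrow> bool" where
  "sym_pd n A \<longleftrightarrow> A \<in> carrier_mat n n \<and> transpose_mat A = A \<and>
     (\<forall>x \<in> carrier_vec n. x \<noteq> 0\<^sub>v n \<longrightarrow> 0 < x \<bullet> (A *\<^sub>v x))"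

abbreviation minv :: "real mat \<Rightarrow> real mat" where
  "minv A \<equiv> the (mat_inverse A)"


section \<open>The finite difference side\<close>

record fd_operator =
  npts :: nat
  Hmat :: "real mat"
  Amat :: "real mat"
  dfst :: "real Matrix.vec"
  dlst :: "real Matrix.vec"

definition step1 :: "fd_operator \<Rightarrow> real" where
  "step1 G = 1 / (real (npts G) - 1)"

text \<open>A first derivative approximation at any point is a functional on grid functions that is exact
  for affine functions; the grid points in one direction are \<open>k * step1 G\<close> for \<open>k < npts G\<close>.\<close>

definition derivative_approx :: "fd_operator \<Rightarrow> real Matrix.vec \<Rightarrow> bool" where
  "derivative_approx G d \<longleftrightarrow> d \<in> carrier_vec (npts G) \<and>
     (\<Sum>k<npts G. d $ k) = 0 \<and> (\<Sum>k<npts G. d $ k * (real k * step1 G)) = 1"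

definition sbp_operator :: "fd_operator \<Rightarrow> bool" where
  "sbp_operator G \<longleftrightarrow> npts G \<ge> 2 \<and>
     sym_pd (npts G) (Hmat G) \<and> diagonal_mat (Hmat G) \<and> sym_psd (npts G) (Amat G) \<and>
     derivative_approx G (dfst G) \<and> derivative_approx G (dlst G)"

definition borrowable :: "fd_operator \<Rightarrow> real \<Rightarrow> bool" where
  "borrowable G \<beta> \<longleftrightarrow> sym_psd (npts G)
     (Amat G - (\<beta> * step1 G) \<cdot>\<^sub>m (outer_prod (dfst G) (dfst G) + outer_prod (dlst G) (dlst G)))"

definition borrowing_capacity :: "fd_operator \<Rightarrow> real \<Rightarrow> bool" where
  "borrowing_capacity G \<beta> \<longleftrightarrow> \<beta> > 0 \<and> borrowable G \<beta> \<and> (\<forall>\<beta>'. borrowable G \<beta>' \<longrightarrow> \<beta>' \<le> \<beta>)"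

definition e_first :: "fd_operator \<Rightarrow> real Matrix.vec" where
  "e_first G = unit_vec (npts G) 0"

definition e_last :: "fd_operator \<Rightarrow> real Matrix.vec" where
  "e_last G = unit_vec (npts G) (npts G - 1)"

definition D1 :: "fd_operator \<Rightarrow> real mat" where
  "D1 G = minv (Hmat G) *
     (- Amat G + outer_prod (e_last G) (dlst G) - outer_prod (e_first G) (dfst G))"

definition D2 :: "fd_operator \<Rightarrow> real mat" where
  "D2 G = D1 G \<otimes>\<^sub>k 1\<^sub>m (npts G) + 1\<^sub>m (npts G) \<otimes>\<^sub>k D1 G"

definition H2 :: "fd_operator \<Rightarrow> real mat" where
  "H2 G = Hmat G \<otimes>\<^sub>k Hmat G"

definition e_Gam :: "fd_operator \<Rightarrow> real mat" where
  "e_Gam G = 1\<^sub>m (npts G) \<otimes>\<^sub>k col_mat (e_first G)"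

definition d_Gam :: "fd_operator \<Rightarrow> real mat" where
  "d_Gam G = - (1\<^sub>m (npts G) \<otimes>\<^sub>k col_mat (dfst G))"

text \<open>In \<open>H2 G * D2 G\<close> the first derivatives enter on all four sides of the square. The first Kronecker
  factor is the \<open>x\<close> direction and the second one the \<open>y\<close> direction, so the sides \<open>x = 0\<close>, \<open>x = 1\<close> and
  \<open>y = 1\<close> give the following terms, and the interface \<open>y = 0\<close> gives the remaining one,
  \<open>- (Hmat G \<otimes>\<^sub>k outer_prod (e_first G) (dfst G)) = e_Gam G * Hmat G * transpose_mat (d_Gam G)\<close>.
  Contributions from the outer boundary are not considered, so they are taken out of \<open>D2 G\<close>.\<close>

definition outer_terms :: "fd_operator \<Rightarrow> real mat" where
  "outer_terms G =
     (outer_prod (e_last G) (dlst G) - outer_prod (e_first G) (dfst G)) \<otimes>\<^sub>k Hmat G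
     + Hmat G \<otimes>\<^sub>k outer_prod (e_last G) (dlst G)"

definition D2_inner :: "fd_operator \<Rightarrow> real mat" where
  "D2_inner G = D2 G - minv (H2 G) * outer_terms G"

definition w_Gam :: "fd_operator \<Rightarrow> real Matrix.vec \<Rightarrow> real Matrix.vec" where
  "w_Gam G w = transpose_mat (e_Gam G) *\<^sub>v w"

definition dw_Gam :: "fd_operator \<Rightarrow> real Matrix.vec \<Rightarrow> real Matrix.vec" where
  "dw_Gam G w = transpose_mat (d_Gam G) *\<^sub>v w"


section \<open>The discontinuous Galerkin side\<close>

type_synonym point = "real \<times> real"

definition Omega1 :: "point set" where
  "Omega1 = {0..1} \<times> {0..1}"

definition Omega2 :: "point set" where
  "Omega2 = {0..1} \<times> {-1..0}"

definition Gam :: "point set" where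
  "Gam = Omega1 \<inter> Omega2"

definition triangulates :: "point set set \<Rightarrow> point set \<Rightarrow> bool" where
  "triangulates \<K> \<Omega> \<longleftrightarrow> triangulation \<K> \<and> (\<forall>K\<in>\<K>. 2 simplex K) \<and> \<Union>\<K> = \<Omega>"

text \<open>Shape regularity is a property of a family of meshes: the ratio of diameter and inradius is
  bounded over all elements of all meshes.\<close>

definition shape_regular :: "point set set set \<Rightarrow> bool" where
  "shape_regular \<KK> \<longleftrightarrow> (\<exists>\<rho>. \<forall>\<K>\<in>\<KK>. \<forall>K\<in>\<K>. \<exists>c r. 0 < r \<and> cball c r \<subseteq> K \<and> diameter K \<le> \<rho> * r)"

definition polys :: "nat \<Rightarrow> (point \<Rightarrow> real) set" where
  "polys q = {p. \<exists>c. \<forall>x y. p (x, y) = (\<Sum>a\<le>q. \<Sum>b\<le>q - a. c a b * x ^ a * y ^ b)}"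

text \<open>A discontinuous piecewise polynomial is given by its polynomial on each element, since it has
  several values at points that elements share. A polynomial on an element is identified with the
  polynomial on the whole plane that extends it.\<close>

type_synonym dgfun = "point set \<Rightarrow> point \<Rightarrow> real"

definition DG_space :: "nat \<Rightarrow> point set set \<Rightarrow> dgfun set" where
  "DG_space q \<K> = {v. \<forall>K\<in>\<K>. v K \<in> polys q}"

definition grad :: "(point \<Rightarrow> real) \<Rightarrow> point \<Rightarrow> point" where
  "grad p z = (THE g. GDERIV p z :> g)"

text \<open>The face \<open>K \<inter> Gam\<close> is represented by the element \<open>K\<close> it belongs to. The list \<open>faces\<close> fixes an
  order of the faces; \<open>nodes R k\<close> are the \<open>x\<close> coordinates of the Lagrange nodes on the \<open>k\<close>-th face.\<close>

record dg_mesh =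
  elems :: "point set set"
  faces :: "point set list"
  nodes :: "nat \<Rightarrow> nat \<Rightarrow> real"

definition interface_elems :: "point set set \<Rightarrow> point set set" where
  "interface_elems \<K> = {K \<in> \<K>. aff_dim (K \<inter> Gam) = 1}"

definition mesh_size :: "dg_mesh \<Rightarrow> real" where
  "mesh_size R = Max (diameter ` elems R)"

definition nfaces :: "dg_mesh \<Rightarrow> nat" where
  "nfaces R = length (faces R)"

definition face_coords :: "dg_mesh \<Rightarrow> nat \<Rightarrow> real set" where
  "face_coords R k = {x. (x, 0) \<in> faces R ! k \<inter> Gam}"

definition dg_discretization :: "nat \<Rightarrow> dg_mesh \<Rightarrow> bool" where
  "dg_discretization q R \<longleftrightarrow> triangulates (elems R) Omega2 \<and>
     distinct (faces R) \<and> set (faces R) = interface_elems (elems R) \<and>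
     (\<forall>k<nfaces R. inj_on (nodes R k) {..q} \<and> nodes R k ` {..q} \<subseteq> face_coords R k)"

definition dg_inner :: "dg_mesh \<Rightarrow> dgfun \<Rightarrow> dgfun \<Rightarrow> real" where
  "dg_inner R u v = (\<Sum>K\<in>elems R. LINT z:K|lborel. u K z * v K z)"

definition dg_grad_inner :: "dg_mesh \<Rightarrow> dgfun \<Rightarrow> dgfun \<Rightarrow> real" where
  "dg_grad_inner R u v = (\<Sum>K\<in>elems R. LINT z:K|lborel. inner (grad (u K) z) (grad (v K) z))"

text \<open>Functions on an interface face are functions of \<open>x\<close>.\<close>

definition face_inner :: "dg_mesh \<Rightarrow> nat \<Rightarrow> (real \<Rightarrow> real) \<Rightarrow> (real \<Rightarrow> real) \<Rightarrow> real" where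
  "face_inner R k p r = (LINT x:face_coords R k|lborel. p x * r x)"

definition trace :: "dg_mesh \<Rightarrow> dgfun \<Rightarrow> nat \<Rightarrow> real \<Rightarrow> real" where
  "trace R u k x = u (faces R ! k) (x, 0)"

definition normal_deriv :: "dg_mesh \<Rightarrow> dgfun \<Rightarrow> nat \<Rightarrow> real \<Rightarrow> real" where
  "normal_deriv R u k x = inner (grad (u (faces R ! k)) (x, 0)) (0, 1)"

definition discrete_trace_ineq :: "nat \<Rightarrow> dg_mesh \<Rightarrow> real \<Rightarrow> bool" where
  "discrete_trace_ineq q R C \<longleftrightarrow> (\<forall>u\<in>DG_space q (elems R).
     dg_grad_inner R u u \<ge>
       C * mesh_size R * (\<Sum>k<nfaces R. face_inner R k (normal_deriv R u k) (normal_deriv R u k)))"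

definition lagrange :: "nat \<Rightarrow> dg_mesh \<Rightarrow> nat \<Rightarrow> nat \<Rightarrow> real \<Rightarrow> real" where
  "lagrange q R k j x = (\<Prod>m\<in>{..q} - {j}. (x - nodes R k m) / (nodes R k j - nodes R k m))"

text \<open>Coefficient vectors on the interface have a block of \<open>q + 1\<close> entries for each face: the entry
  for the \<open>j\<close>-th node of the \<open>k\<close>-th face has index \<open>k * (q + 1) + j\<close>. The Lagrange coefficients of a
  polynomial of degree at most \<open>q\<close> on a face are its values at the nodes.\<close>

definition ndof :: "nat \<Rightarrow> dg_mesh \<Rightarrow> nat" where
  "ndof q R = nfaces R * (q + 1)"

definition lagrange_coeffs :: "nat \<Rightarrow> dg_mesh \<Rightarrow> (nat \<Rightarrow> real \<Rightarrow> real) \<Rightarrow> real Matrix.vec" where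
  "lagrange_coeffs q R p = Matrix.vec (ndof q R)
     (\<lambda>a. p (a div (q + 1)) (nodes R (a div (q + 1)) (a mod (q + 1))))"

definition face_fun :: "nat \<Rightarrow> dg_mesh \<Rightarrow> real Matrix.vec \<Rightarrow> nat \<Rightarrow> real \<Rightarrow> real" where
  "face_fun q R c k x = (\<Sum>j\<le>q. c $ (k * (q + 1) + j) * lagrange q R k j x)"

definition u_Gam :: "nat \<Rightarrow> dg_mesh \<Rightarrow> dgfun \<Rightarrow> real Matrix.vec" where
  "u_Gam q R u = lagrange_coeffs q R (trace R u)"

definition uy_Gam :: "nat \<Rightarrow> dg_mesh \<Rightarrow> dgfun \<Rightarrow> real Matrix.vec" where
  "uy_Gam q R u = lagrange_coeffs q R (normal_deriv R u)"

definition Mmat :: "nat \<Rightarrow> dg_mesh \<Rightarrow> real mat" where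
  "Mmat q R = Matrix.mat (ndof q R) (ndof q R) (\<lambda>(a, b).
     if a div (q + 1) = b div (q + 1)
     then face_inner R (a div (q + 1)) (lagrange q R (a div (q + 1)) (a mod (q + 1)))
            (lagrange q R (b div (q + 1)) (b mod (q + 1)))
     else 0)"


section \<open>The coupled semidiscretization\<close>

record projections =
  Pg_uw :: "real mat"
  Pb_uw :: "real mat"
  Pg_wu :: "real mat"
  Pb_wu :: "real mat"

definition norm_compatible :: "nat \<Rightarrow> fd_operator \<Rightarrow> dg_mesh \<Rightarrow> projections \<Rightarrow> bool" where
  "norm_compatible q G R P \<longleftrightarrow>
     Pg_uw P \<in> carrier_mat (npts G) (ndof q R) \<and> Pb_uw P \<in> carrier_mat (npts G) (ndof q R) \<and>
     Pg_wu P \<in> carrier_mat (ndof q R) (npts G) \<and> Pb_wu P \<in> carrier_mat (ndof q R) (npts G) \<and>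
     Hmat G * Pg_uw P = transpose_mat (Mmat q R * Pb_wu P) \<and>
     Hmat G * Pb_uw P = transpose_mat (Mmat q R * Pg_wu P)"

record parameters =
  b1 :: real
  b2 :: real
  tau_w :: real
  sigma_w :: real
  tau_u :: real
  sigma_u :: real

definition fd_rhs :: "parameters \<Rightarrow> nat \<Rightarrow> fd_operator \<Rightarrow> dg_mesh \<Rightarrow> projections \<Rightarrow>
    real Matrix.vec \<Rightarrow> dgfun \<Rightarrow> real Matrix.vec" where
  "fd_rhs \<pi> q G R P w u =
    (let r = w_Gam G w - Pg_uw P *\<^sub>v u_Gam q R u;
         s = Pg_wu P *\<^sub>v w_Gam G w - u_Gam q R u;
         uy = uy_Gam q R u
     in b1 \<pi> \<cdot>\<^sub>v (D2_inner G *\<^sub>v w)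
        + minv (H2 G) *\<^sub>v
           ((1/2 * b1 \<pi>) \<cdot>\<^sub>v (d_Gam G *\<^sub>v (Hmat G *\<^sub>v r))
            - (1/2) \<cdot>\<^sub>v (e_Gam G *\<^sub>v (Hmat G *\<^sub>v
                 (b1 \<pi> \<cdot>\<^sub>v dw_Gam G w + Pb_uw P *\<^sub>v (b2 \<pi> \<cdot>\<^sub>v uy)))))
        - minv (H2 G) *\<^sub>v
           ((b1 \<pi> * tau_w \<pi> / step1 G) \<cdot>\<^sub>v (e_Gam G *\<^sub>v (Hmat G *\<^sub>v r))
            + (b2 \<pi> * sigma_w \<pi> / mesh_size R) \<cdot>\<^sub>v
                (e_Gam G *\<^sub>v (Hmat G *\<^sub>v (Pb_uw P *\<^sub>v s)))))"

text \<open>The gradients in \<open>dg_grad_inner\<close> are taken element by element, and only faces on the interface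
  contribute face terms.\<close>

definition dg_rhs :: "parameters \<Rightarrow> nat \<Rightarrow> fd_operator \<Rightarrow> dg_mesh \<Rightarrow> projections \<Rightarrow>
    real Matrix.vec \<Rightarrow> dgfun \<Rightarrow> dgfun \<Rightarrow> real" where
  "dg_rhs \<pi> q G R P w u \<phi> =
    (let wF = face_fun q R (Pg_wu P *\<^sub>v w_Gam G w);
         wN = face_fun q R (Pb_wu P *\<^sub>v dw_Gam G w);
         uu = face_fun q R (Pb_wu P *\<^sub>v (Pg_uw P *\<^sub>v u_Gam q R u));
         ww = face_fun q R (Pb_wu P *\<^sub>v w_Gam G w)
     in - (b2 \<pi> * dg_grad_inner R u \<phi>)
        + (\<Sum>k<nfaces R.
            1/2 * b2 \<pi> * face_inner R k (\<lambda>x. trace R u k x - wF k x) (normal_deriv R \<phi> k)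
            + 1/2 * face_inner R k (\<lambda>x. b2 \<pi> * normal_deriv R u k x - b1 \<pi> * wN k x) (trace R \<phi> k))
        - (\<Sum>k<nfaces R.
            tau_u \<pi> / mesh_size R * b2 \<pi> *
              face_inner R k (\<lambda>x. trace R u k x - wF k x) (trace R \<phi> k)
            + sigma_u \<pi> / step1 G * b1 \<pi> *
              face_inner R k (\<lambda>x. uu k x - ww k x) (trace R \<phi> k)))"

text \<open>The functions \<open>w'\<close>, \<open>w''\<close>, \<open>u'\<close>, \<open>u''\<close> are the time derivatives of \<open>w\<close> and \<open>u\<close>; at the final
  time \<open>T\<close> the derivatives are one-sided.\<close>

definition vec_time_deriv ::
    "real \<Rightarrow> nat \<Rightarrow> (real \<Rightarrow> real Matrix.vec) \<Rightarrow> (real \<Rightarrow> real Matrix.vec) \<Rightarrow> bool" where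
  "vec_time_deriv T N w w' \<longleftrightarrow> (\<forall>t\<in>{0<..T}. w t \<in> carrier_vec N \<and> w' t \<in> carrier_vec N \<and>
     (\<forall>i<N. ((\<lambda>s. w s $ i) has_real_derivative w' t $ i) (at t within {0<..T})))"

definition dg_time_deriv ::
    "real \<Rightarrow> nat \<Rightarrow> dg_mesh \<Rightarrow> (real \<Rightarrow> dgfun) \<Rightarrow> (real \<Rightarrow> dgfun) \<Rightarrow> bool" where
  "dg_time_deriv T q R u u' \<longleftrightarrow>
     (\<forall>t\<in>{0<..T}. u t \<in> DG_space q (elems R) \<and> u' t \<in> DG_space q (elems R) \<and>
       (\<forall>K\<in>elems R. \<forall>z. ((\<lambda>s. u s K z) has_real_derivative u' t K z) (at t within {0<..T})))"

definition semidiscrete_solution :: "real \<Rightarrow> parameters \<Rightarrow> nat \<Rightarrow> fd_operator \<Rightarrow> dg_mesh \<Rightarrow>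
    projections \<Rightarrow> (real \<Rightarrow> real Matrix.vec) \<Rightarrow> (real \<Rightarrow> real Matrix.vec) \<Rightarrow>
    (real \<Rightarrow> dgfun) \<Rightarrow> (real \<Rightarrow> dgfun) \<Rightarrow> bool" where
  "semidiscrete_solution T \<pi> q G R P w w' u u' \<longleftrightarrow>
     vec_time_deriv T (npts G * npts G) w w' \<and> dg_time_deriv T q R u u' \<and>
     (\<exists>w'' u''. vec_time_deriv T (npts G * npts G) w' w'' \<and> dg_time_deriv T q R u' u'' \<and>
       (\<forall>t\<in>{0<..T}. w'' t = fd_rhs \<pi> q G R P (w t) (u t) \<and>
          (\<forall>\<phi>\<in>DG_space q (elems R). dg_inner R (u'' t) \<phi> = dg_rhs \<pi> q G R P (w t) (u t) \<phi>)))"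

definition E1 :: "parameters \<Rightarrow> nat \<Rightarrow> fd_operator \<Rightarrow> dg_mesh \<Rightarrow> projections \<Rightarrow>
    real Matrix.vec \<Rightarrow> dgfun \<Rightarrow> real" where
  "E1 \<pi> q G R P w u =
    (let r = w_Gam G w - Pg_uw P *\<^sub>v u_Gam q R u
     in - 1/2 *
       (b1 \<pi> * (w \<bullet> ((Amat G \<otimes>\<^sub>k Hmat G + Hmat G \<otimes>\<^sub>k Amat G) *\<^sub>v w))
        + b1 \<pi> * tau_w \<pi> / step1 G * (r \<bullet> (Hmat G *\<^sub>v r))
        - b1 \<pi> * (dw_Gam G w \<bullet> (Hmat G *\<^sub>v r))))"

definition E2 :: "parameters \<Rightarrow> nat \<Rightarrow> fd_operator \<Rightarrow> dg_mesh \<Rightarrow> projections \<Rightarrow>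
    real Matrix.vec \<Rightarrow> dgfun \<Rightarrow> real" where
  "E2 \<pi> q G R P w u =
    (let s = u_Gam q R u - Pg_wu P *\<^sub>v w_Gam G w
     in - 1/2 *
       (b2 \<pi> * dg_grad_inner R u u
        + b2 \<pi> * tau_u \<pi> / mesh_size R * (s \<bullet> (Mmat q R *\<^sub>v s))
        - b2 \<pi> * (s \<bullet> (Mmat q R *\<^sub>v uy_Gam q R u))))"

definition energy :: "parameters \<Rightarrow> nat \<Rightarrow> fd_operator \<Rightarrow> dg_mesh \<Rightarrow> projections \<Rightarrow>
    real Matrix.vec \<Rightarrow> real Matrix.vec \<Rightarrow> dgfun \<Rightarrow> dgfun \<Rightarrow> real" where
  "energy \<pi> q G R P w w' u u' =
     w' \<bullet> (H2 G *\<^sub>v w') + dg_inner R u' u' - 2 * E1 \<pi> q G R P w u - 2 * E2 \<pi> q G R P w u"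

text \<open>The signs of \<open>E1\<close> and \<open>E2\<close> are required for all grid functions and all piecewise polynomials,
  not only for those that solutions attain.\<close>

definition energy_stable :: "real \<Rightarrow> parameters \<Rightarrow> nat \<Rightarrow> fd_operator \<Rightarrow> dg_mesh \<Rightarrow> projections \<Rightarrow> bool" where
  "energy_stable T \<pi> q G R P \<longleftrightarrow>
     (\<forall>w w' u u'. semidiscrete_solution T \<pi> q G R P w w' u u' \<longrightarrow>
       (\<forall>t\<in>{0<..T}. ((\<lambda>s. energy \<pi> q G R P (w s) (w' s) (u s) (u' s))
                        has_real_derivative 0) (at t within {0<..T}))) \<and>
     (\<forall>w \<in> carrier_vec (npts G * npts G). \<forall>u \<in> DG_space q (elems R).
       E1 \<pi> q G R P w u \<le> 0 \<and> E2 \<pi> q G R P w u \<le> 0)"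

end

theory Submission
  imports Defs "HOL-Computational_Algebra.Polynomial"
begin

text \<open>
The energy is conserved because every interface term that one side feeds into its own equation
is returned, with the opposite sign, by the other side or by the derivative of the interface part
of the energy. Testing the finite difference equation with \<open>w'\<close> and the Galerkin equation with
\<open>u'\<close> turns the derivative of \<open>E\<close> into volume terms, which cancel by symmetry, and bilinear forms in
the interface data. The forms on the
grid use the weight \<open>H\<close>, the ones on the mesh use the mass matrix \<open>M\<close>. Norm compatibility is the
adjointness \<open>x \<bullet> H Pg_uw y = y \<bullet> M Pb_wu x\<close>, \<open>x \<bullet> H Pb_uw y = y \<bullet> M Pg_wu x\<close>
(\<open>norm_compatible_forms\<close>), so a term that a side receives through a \<open>g\<close> projection can be compared
with the term that the other side receives through the matching \<open>b\<close> projection. The flux terms then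
cancel identically, and the penalty terms cancel because \<open>\<tau>\<^sub>w = \<sigma>\<^sub>u\<close> and \<open>\<tau>\<^sub>u = \<sigma>\<^sub>w\<close>
(\<open>energy_conserved\<close>). The inputs of this computation are the summation-by-parts identity
\<open>H2_mult_D2_inner\<close>, which writes \<open>\<H>\<D>\<close> as minus the stiffness matrix plus the interface flux, and
\<open>dg_rhs_eq_Mmat\<close>, which writes the face integrals as forms in the Lagrange coefficients.

The signs of \<open>E1\<close> and \<open>E2\<close> are right because the only indefinite term of each, a product of a normal derivative and a jump, is absorbed by Young's inequality for a
positive semidefinite form (\<open>young_inequality_psd\<close>). The square of the normal derivative that this
costs is available inside the volume term: on the grid since the borrowing capacity allows
\<open>\<beta> h\<^sub>1\<close> times it to be taken out of \<open>A\<close>, row by row in the direction normal to the interface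
(\<open>fd_stiffness_bound\<close>), and on the mesh by the discrete trace inequality. The square of the jump is
paid for by the penalty, and this is where the lower bounds on the penalty parameters enter.

Differentiating in time requires that the integrals depend on finitely many numbers that are
differentiable in time, while the Galerkin solution is only known to be differentiable pointwise.
Interpolation on a tensor grid of \<open>(q + 1)\<^sup>2\<close> points expresses a polynomial and its gradient linearly
through point values, with coefficients that do not depend on the polynomial
(\<open>polys_tensor_expansion\<close>, \<open>grad_tensor_expansion\<close>). This makes all volume integrals quadratic forms
in these values (\<open>dg_quadratic_time_deriv\<close>). The same expansion shows that the traces on a face are
polynomials of degree at most \<open>q\<close> and hence agree with their Lagrange interpolants.
\<close>

section \<open>Bilinear forms given by matrices\<close>

lemma mat_vec_add: "dim_vec a = dim_col A \<Longrightarrow> dim_vec b = dim_col A \<Longrightarrow>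
    A *\<^sub>v (a + b) = A *\<^sub>v a + A *\<^sub>v (b :: real Matrix.vec)"
  by (rule mult_add_distrib_mat_vec[of _ "dim_row A" "dim_col A"]) (auto intro!: carrier_vecI)

lemma mat_vec_smult: "dim_vec a = dim_col A \<Longrightarrow> A *\<^sub>v (c \<cdot>\<^sub>v a) = c \<cdot>\<^sub>v (A *\<^sub>v (a :: real Matrix.vec))"
  by (rule mult_mat_vec[of _ "dim_row A" "dim_col A"]) (auto intro!: carrier_vecI)

lemma mat_vec_diff: "dim_vec a = dim_col A \<Longrightarrow> dim_vec b = dim_col A \<Longrightarrow>
    A *\<^sub>v (a - b) = A *\<^sub>v a - A *\<^sub>v (b :: real Matrix.vec)"
  by (intro eq_vecI) (auto simp: scalar_prod_def right_diff_distrib sum_subtractf)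

lemma mat_vec_uminus: "dim_vec a = dim_col A \<Longrightarrow> A *\<^sub>v (- a) = - (A *\<^sub>v (a :: real Matrix.vec))"
  by (intro eq_vecI) auto

lemma scalar_prod_add_right: "dim_vec x = dim_vec a \<Longrightarrow> dim_vec x = dim_vec b \<Longrightarrow>
    x \<bullet> (a + b) = x \<bullet> a + x \<bullet> (b :: real Matrix.vec)"
  by (rule scalar_prod_add_distrib[of _ "dim_vec a"]) (auto intro!: carrier_vecI)

lemma scalar_prod_diff_right: "dim_vec x = dim_vec a \<Longrightarrow> dim_vec x = dim_vec b \<Longrightarrow>
    x \<bullet> (a - b) = x \<bullet> a - x \<bullet> (b :: real Matrix.vec)"
  by (rule scalar_prod_minus_distrib[of _ "dim_vec a"]) (auto intro!: carrier_vecI)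

lemma scalar_prod_add_left: "dim_vec x = dim_vec a \<Longrightarrow> dim_vec x = dim_vec b \<Longrightarrow>
    (a + b) \<bullet> x = a \<bullet> x + b \<bullet> (x :: real Matrix.vec)"
  by (rule add_scalar_prod_distrib[of _ "dim_vec a"]) (auto intro!: carrier_vecI)

lemma scalar_prod_diff_left: "dim_vec x = dim_vec a \<Longrightarrow> dim_vec x = dim_vec b \<Longrightarrow>
    (a - b) \<bullet> x = a \<bullet> x - b \<bullet> (x :: real Matrix.vec)"
  by (rule minus_scalar_prod_distrib[of _ "dim_vec a"]) (auto intro!: carrier_vecI)

lemma mat_add_vec: "dim_vec x = dim_col A \<Longrightarrow> dim_col B = dim_col A \<Longrightarrow> dim_row B = dim_row A \<Longrightarrow>
    (A + B) *\<^sub>v x = A *\<^sub>v x + B *\<^sub>v (x :: real Matrix.vec)"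
  by (rule add_mult_distrib_mat_vec[of _ "dim_row A" "dim_col A"]) (auto intro!: carrier_vecI)

lemma mat_diff_vec: "dim_vec x = dim_col A \<Longrightarrow> dim_col B = dim_col A \<Longrightarrow> dim_row B = dim_row A \<Longrightarrow>
    (A - B) *\<^sub>v x = A *\<^sub>v x - B *\<^sub>v (x :: real Matrix.vec)"
  by (rule minus_mult_distrib_mat_vec[of _ "dim_row A" "dim_col A"]) (auto intro!: carrier_vecI)

lemma mat_smult_vec: "dim_vec x = dim_col A \<Longrightarrow> (c \<cdot>\<^sub>m A) *\<^sub>v x = c \<cdot>\<^sub>v (A *\<^sub>v (x :: real Matrix.vec))"
  by (intro eq_vecI) (auto simp: scalar_prod_def sum_distrib_left mult_ac)

lemmas bilinear_expand = mat_vec_add mat_vec_smult mat_vec_diff scalar_prod_add_right scalar_prod_diff_right scalar_prod_add_left scalar_prod_diff_left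
  scalar_prod_smult_right scalar_prod_smult_left

lemma scalar_prod_transpose_swap:
  fixes A :: "real mat"
  assumes "A \<in> carrier_mat nr nc" "x \<in> carrier_vec nr" "y \<in> carrier_vec nc"
  shows "x \<bullet> (A *\<^sub>v y) = y \<bullet> (transpose_mat A *\<^sub>v x)"
proof -
  have "y \<bullet> (transpose_mat A *\<^sub>v x) = (transpose_mat A *\<^sub>v x) \<bullet> y"
    by (rule comm_scalar_prod[of _ nc]) (use assms in auto)
  also have "\<dots> = x \<bullet> (A *\<^sub>v y)"
    by (rule transpose_vec_mult_scalar) (use assms in auto)
  finally show ?thesis by simp
qed

lemma symmetric_form_commute:
  fixes A :: "real mat"
  assumes "A \<in> carrier_mat n n" "transpose_mat A = A" "x \<in> carrier_vec n" "y \<in> carrier_vec n"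
  shows "x \<bullet> (A *\<^sub>v y) = y \<bullet> (A *\<^sub>v x)"
  using scalar_prod_transpose_swap[of A n n x y] assms by simp

text \<open>This is the inequality \<open>2 a b \<le> \<epsilon> a\<^sup>2 + b\<^sup>2 / \<epsilon>\<close> in a semi-inner product. It bounds the products of jumps
and normal derivatives in the energy.\<close>

lemma young_inequality_psd:
  fixes A :: "real mat"
  assumes A: "A \<in> carrier_mat n n" "transpose_mat A = A"
    and psd: "\<And>z. z \<in> carrier_vec n \<Longrightarrow> 0 \<le> z \<bullet> (A *\<^sub>v z)"
    and x: "x \<in> carrier_vec n" and y: "y \<in> carrier_vec n"
    and \<theta>: "\<theta> > 0"
  shows "x \<bullet> (A *\<^sub>v y) \<le> \<theta> * (y \<bullet> (A *\<^sub>v y)) + 1 / (4 * \<theta>) * (x \<bullet> (A *\<^sub>v x))"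
proof -
  \<comment> \<open>The square whose mixed term has the weight that the claim needs.\<close>
  have "0 \<le> ((2 * \<theta>) \<cdot>\<^sub>v y - x) \<bullet> (A *\<^sub>v ((2 * \<theta>) \<cdot>\<^sub>v y - x))"
    by (rule psd) (use x y in auto)
  also have "\<dots> = 4 * \<theta>\<^sup>2 * (y \<bullet> (A *\<^sub>v y)) - 4 * \<theta> * (x \<bullet> (A *\<^sub>v y)) + x \<bullet> (A *\<^sub>v x)"
    using A x y symmetric_form_commute[OF A x y]
    by (simp add: bilinear_expand power2_eq_square algebra_simps)
  finally show ?thesis using \<theta>
    by (simp add: field_simps power2_eq_square)
qed

section \<open>Kronecker products\<close>

text \<open>A Kronecker index runs over pairs of indices in row-major order, so sums over it are double sums.\<close>

lemma sum_div_mod: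
  fixes f :: "nat \<Rightarrow> nat \<Rightarrow> 'a :: comm_monoid_add"
  shows "(\<Sum>k<m * n. f (k div n) (k mod n)) = (\<Sum>i<m. \<Sum>j<n. f i j)"
proof -
  have "(\<Sum>k<m * n. f (k div n) (k mod n)) = (\<Sum>i<m. \<Sum>k=i*n..<i*n+n. f (k div n) (k mod n))"
    by (rule sum.nat_group[symmetric])
  also have "\<dots> = (\<Sum>i<m. \<Sum>j<n. f i j)"
  proof (rule sum.cong[OF refl])
    fix i
    have "(\<Sum>k=i*n..<i*n+n. f (k div n) (k mod n)) = (\<Sum>j=0..<n. f ((j + i*n) div n) ((j + i*n) mod n))"
      using sum.shift_bounds_nat_ivl[of "\<lambda>k. f (k div n) (k mod n)" 0 "i*n" n] by (simp add: add.commute)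
    also have "\<dots> = (\<Sum>j<n. f i j)"
      by (simp add: lessThan_atLeast0)
    finally show "(\<Sum>k=i*n..<i*n+n. f (k div n) (k mod n)) = (\<Sum>j<n. f i j)" .
  qed
  finally show ?thesis .
qed

lemma div_mod_less:
  assumes "(i::nat) < m * n"
  shows "i div n < m" "i mod n < n"
proof -
  show "i div n < m" using assms by (rule less_mult_imp_div_less)
  have "n \<noteq> 0" using assms by (rule contrapos_pn) simp
  then show "i mod n < n" by simp
qed

lemma block_index_less:
  assumes "i < m" "j < n"
  shows "i * n + j < m * (n::nat)"
proof -
  have "i * n + j < Suc i * n" using assms(2) by simp
  also have "\<dots> \<le> m * n" by (rule mult_le_mono1) (use assms(1) in simp)
  finally show ?thesis .
qed

lemma dim_kron [simp]: "dim_row (A \<otimes>\<^sub>k B) = dim_row A * dim_row B"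
  "dim_col (A \<otimes>\<^sub>k B) = dim_col A * dim_col B"
  by (auto simp: kron_def)

lemma kron_carrier: "A \<in> carrier_mat a b \<Longrightarrow> B \<in> carrier_mat c d \<Longrightarrow> A \<otimes>\<^sub>k B \<in> carrier_mat (a * c) (b * d)"
  by auto

lemma kron_index [simp]: "i < dim_row A * dim_row B \<Longrightarrow> j < dim_col A * dim_col B \<Longrightarrow>
  (A \<otimes>\<^sub>k B) $$ (i, j) = A $$ (i div dim_row B, j div dim_col B) * B $$ (i mod dim_row B, j mod dim_col B)"
  by (simp add: kron_def)

lemma kron_mult:
  assumes "A \<in> carrier_mat a b" "B \<in> carrier_mat c d" "C \<in> carrier_mat b e" "D \<in> carrier_mat d f"
  shows "(A \<otimes>\<^sub>k B) * (C \<otimes>\<^sub>k D) = (A * C) \<otimes>\<^sub>k (B * D)"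
proof (rule eq_matI)
  fix i j assume ij: "i < dim_row ((A * C) \<otimes>\<^sub>k (B * D))" "j < dim_col ((A * C) \<otimes>\<^sub>k (B * D))"
  then have ij': "i < a * c" "j < e * f" using assms by auto
  then have dm: "i div c < a" "i mod c < c" "j div f < e" "j mod f < f" by (auto dest: div_mod_less)
  have "((A \<otimes>\<^sub>k B) * (C \<otimes>\<^sub>k D)) $$ (i, j) =
     (\<Sum>k<b * d. (\<lambda>k l. A $$ (i div c, k) * B $$ (i mod c, l) * (C $$ (k, j div f) * D $$ (l, j mod f)))
         (k div d) (k mod d))"
    using assms ij' by (auto simp: scalar_prod_def lessThan_atLeast0 intro!: sum.cong)
  also have "\<dots> = (\<Sum>k<b. \<Sum>l<d. A $$ (i div c, k) * B $$ (i mod c, l) * (C $$ (k, j div f) * D $$ (l, j mod f)))"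
    by (rule sum_div_mod)
  also have "\<dots> = (\<Sum>k<b. A $$ (i div c, k) * C $$ (k, j div f)) * (\<Sum>l<d. B $$ (i mod c, l) * D $$ (l, j mod f))"
    by (simp add: sum_product mult_ac)
  also have "\<dots> = ((A * C) \<otimes>\<^sub>k (B * D)) $$ (i, j)"
    using assms ij' dm by (auto simp: scalar_prod_def lessThan_atLeast0)
  finally show "((A \<otimes>\<^sub>k B) * (C \<otimes>\<^sub>k D)) $$ (i, j) = ((A * C) \<otimes>\<^sub>k (B * D)) $$ (i, j)" .
qed (use assms in auto)

lemma transpose_kron: "transpose_mat (A \<otimes>\<^sub>k B) = transpose_mat A \<otimes>\<^sub>k transpose_mat B"
  by (rule eq_matI) (auto simp: div_mod_less)

lemma kron_quadratic_form:
  assumes "A \<in> carrier_mat n n" "B \<in> carrier_mat m m" "w \<in> carrier_vec (n * m)"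
  shows "w \<bullet> ((A \<otimes>\<^sub>k B) *\<^sub>v w) =
    (\<Sum>i<n. \<Sum>j<m. \<Sum>k<n. \<Sum>l<m. w $ (i * m + j) * (A $$ (i, k) * B $$ (j, l) * w $ (k * m + l)))"
proof -
  define F where "F i j k l = w $ (i * m + j) * (A $$ (i, k) * B $$ (j, l) * w $ (k * m + l))" for i j k l
  have "w \<bullet> ((A \<otimes>\<^sub>k B) *\<^sub>v w) =
      (\<Sum>a<n * m. \<Sum>b<n * m. F (a div m) (a mod m) (b div m) (b mod m))"
    using assms by (auto simp: F_def scalar_prod_def lessThan_atLeast0 sum_distrib_left intro!: sum.cong)
  also have "\<dots> = (\<Sum>a<n * m. \<Sum>k<n. \<Sum>l<m. F (a div m) (a mod m) k l)"
    by (intro sum.cong refl sum_div_mod)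
  also have "\<dots> = (\<Sum>i<n. \<Sum>j<m. \<Sum>k<n. \<Sum>l<m. F i j k l)"
    by (rule sum_div_mod[of "\<lambda>i j. \<Sum>k<n. \<Sum>l<m. F i j k l"])
  finally show ?thesis by (simp add: F_def)
qed

text \<open>A row of a diagonal matrix picks out a single summand. This is how diagonality of the norm matrix enters
all the following estimates.\<close>

lemma sum_diagonal:
  assumes "diagonal_mat H" "H \<in> carrier_mat n n" "i < n"
  shows "(\<Sum>k<n. H $$ (i, k) * f k) = H $$ (i, i) * (f i :: real)"
proof -
  have "H $$ (i, k) = 0" if "k < n" "k \<noteq> i" for k
    using assms that unfolding diagonal_mat_def by auto
  then have "(\<Sum>k<n. H $$ (i, k) * f k) = (\<Sum>k<n. if k = i then H $$ (i, i) * f i else 0)"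
    by (intro sum.cong) auto
  then show ?thesis using assms by simp
qed

lemma diagonal_pd_entry_pos:
  assumes "sym_pd n H" "i < n"
  shows "H $$ (i, i) > 0"
proof -
  have H: "H \<in> carrier_mat n n" using assms by (auto simp: sym_pd_def)
  have "0 < unit_vec n i \<bullet> (H *\<^sub>v unit_vec n i)"
    using assms by (auto simp: sym_pd_def)
  also have "\<dots> = H $$ (i, i)" using H assms(2) by simp
  finally show ?thesis .
qed

text \<open>For a diagonal first factor the quadratic form splits into the forms of \<open>A\<close> on the rows of the
grid function, with the positive diagonal entries of \<open>H\<close> as weights.\<close>

lemma kron_diagonal_psd:
  assumes H: "sym_pd n H" "diagonal_mat H" and A: "A \<in> carrier_mat m m"
    and psd: "\<And>z. z \<in> carrier_vec m \<Longrightarrow> 0 \<le> z \<bullet> (A *\<^sub>v z)"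
    and w: "w \<in> carrier_vec (n * m)"
  shows "0 \<le> w \<bullet> ((H \<otimes>\<^sub>k A) *\<^sub>v w)"
proof -
  have Hc: "H \<in> carrier_mat n n" using H by (auto simp: sym_pd_def)
  define z where "z i = Matrix.vec m (\<lambda>j. w $ (i * m + j))" for i
  have "w \<bullet> ((H \<otimes>\<^sub>k A) *\<^sub>v w) = (\<Sum>i<n. \<Sum>j<m. \<Sum>k<n. H $$ (i, k) *
      (\<Sum>l<m. w $ (i * m + j) * (A $$ (j, l) * w $ (k * m + l))))"
    by (simp add: kron_quadratic_form[OF Hc A w] sum_distrib_left mult_ac)
  also have "\<dots> = (\<Sum>i<n. \<Sum>j<m. H $$ (i, i) * (\<Sum>l<m. w $ (i * m + j) * (A $$ (j, l) * w $ (i * m + l))))"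
    by (intro sum.cong refl sum_diagonal[OF H(2) Hc]) auto
  also have "\<dots> = (\<Sum>i<n. H $$ (i, i) * (z i \<bullet> (A *\<^sub>v z i)))"
    using A by (auto simp: z_def scalar_prod_def lessThan_atLeast0 sum_distrib_left intro!: sum.cong)
  also have "\<dots> \<ge> 0"
    by (intro sum_nonneg mult_nonneg_nonneg psd) (auto simp: z_def less_imp_le[OF diagonal_pd_entry_pos[OF H(1)]])
  finally show ?thesis .
qed

text \<open>The counterpart with the roles of rows and columns of the grid function exchanged.\<close>

lemma kron_psd_diagonal:
  assumes H: "sym_pd m H" "diagonal_mat H" and A: "A \<in> carrier_mat n n"
    and psd: "\<And>z. z \<in> carrier_vec n \<Longrightarrow> 0 \<le> z \<bullet> (A *\<^sub>v z)"
    and w: "w \<in> carrier_vec (n * m)"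
  shows "0 \<le> w \<bullet> ((A \<otimes>\<^sub>k H) *\<^sub>v w)"
proof -
  have Hc: "H \<in> carrier_mat m m" using H by (auto simp: sym_pd_def)
  define z where "z j = Matrix.vec n (\<lambda>i. w $ (i * m + j))" for j
  have "w \<bullet> ((A \<otimes>\<^sub>k H) *\<^sub>v w) = (\<Sum>i<n. \<Sum>j<m. \<Sum>k<n. \<Sum>l<m. H $$ (j, l) *
      (w $ (i * m + j) * (A $$ (i, k) * w $ (k * m + l))))"
    by (simp add: kron_quadratic_form[OF A Hc w] mult_ac)
  also have "\<dots> = (\<Sum>i<n. \<Sum>j<m. \<Sum>k<n. H $$ (j, j) * (w $ (i * m + j) * (A $$ (i, k) * w $ (k * m + j))))"
    by (intro sum.cong refl sum_diagonal[OF H(2) Hc]) auto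
  also have "\<dots> = (\<Sum>j<m. \<Sum>i<n. \<Sum>k<n. H $$ (j, j) * (w $ (i * m + j) * (A $$ (i, k) * w $ (k * m + j))))"
    by (rule sum.swap)
  also have "\<dots> = (\<Sum>j<m. H $$ (j, j) * (z j \<bullet> (A *\<^sub>v z j)))"
    using A by (auto simp: z_def scalar_prod_def lessThan_atLeast0 sum_distrib_left intro!: sum.cong)
  also have "\<dots> \<ge> 0"
    by (intro sum_nonneg mult_nonneg_nonneg psd) (auto simp: z_def less_imp_le[OF diagonal_pd_entry_pos[OF H(1)]])
  finally show ?thesis .
qed

text \<open>The entrywise reciprocal of the diagonal is an inverse, so Gauss-Jordan elimination succeeds and its result
is an inverse as well.\<close>

lemma minv_diagonal_mat:
  assumes A: "A \<in> carrier_mat n n" and diag: "diagonal_mat A" and pos: "\<And>i. i < n \<Longrightarrow> A $$ (i, i) \<noteq> 0"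
  shows "minv A \<in> carrier_mat n n" "A * minv A = 1\<^sub>m n"
proof -
  define B where "B = Matrix.mat n n (\<lambda>(i, j). if i = j then 1 / A $$ (i, i) else 0)"
  have B: "B \<in> carrier_mat n n" by (simp add: B_def)
  have "A * B = 1\<^sub>m n"
  proof (rule eq_matI)
    fix i j assume ij: "i < dim_row (1\<^sub>m n)" "j < dim_col (1\<^sub>m n)"
    then have "(A * B) $$ (i, j) = (\<Sum>k<n. A $$ (i, k) * B $$ (k, j))"
      using A B by (auto simp: scalar_prod_def lessThan_atLeast0)
    also have "\<dots> = A $$ (i, i) * B $$ (i, j)"
      by (rule sum_diagonal[OF diag A]) (use ij in auto)
    finally show "(A * B) $$ (i, j) = 1\<^sub>m n $$ (i, j)"
      using ij pos[of i] by (auto simp: B_def)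
  qed (use A B in auto)
  moreover have "B * A = 1\<^sub>m n"
  proof (rule eq_matI)
    fix i j assume ij: "i < dim_row (1\<^sub>m n)" "j < dim_col (1\<^sub>m n)"
    then have "(B * A) $$ (i, j) = (\<Sum>k<n. B $$ (i, k) * A $$ (k, j))"
      using A B by (auto simp: scalar_prod_def lessThan_atLeast0)
    also have "\<dots> = B $$ (i, i) * A $$ (i, j)"
      by (rule sum_diagonal[OF _ B]) (use ij in \<open>auto simp: B_def diagonal_mat_def\<close>)
    finally show "(B * A) $$ (i, j) = 1\<^sub>m n $$ (i, j)"
      using ij pos[of i] diag A by (auto simp: B_def diagonal_mat_def)
  qed (use A B in auto)
  ultimately have "A \<in> Units (ring_mat TYPE(real) n ())"
    unfolding Units_def ring_mat_def using A B by auto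
  then obtain C where "mat_inverse A = Some C"
    using mat_inverse(1)[OF A, where b = "()"] by (cases "mat_inverse A") auto
  with mat_inverse(2)[OF A this] show "minv A \<in> carrier_mat n n" "A * minv A = 1\<^sub>m n" by auto
qed

section \<open>The summation-by-parts operator\<close>

lemma col_mat_carrier [simp]: "v \<in> carrier_vec n \<Longrightarrow> col_mat v \<in> carrier_mat n 1"
  by (auto simp: col_mat_def)

lemma col_mat_index [simp]: "i < dim_vec v \<Longrightarrow> col_mat v $$ (i, 0) = v $ i"
  by (simp add: col_mat_def mat_of_cols_def)

lemma dim_col_mat [simp]: "dim_row (col_mat v) = dim_vec v" "dim_col (col_mat v) = 1"
  by (auto simp: col_mat_def)

lemma outer_prod_carrier:
  "u \<in> carrier_vec n \<Longrightarrow> v \<in> carrier_vec m \<Longrightarrow> outer_prod u v \<in> carrier_mat n m"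
  by (auto intro!: carrier_matI)

lemma outer_prod_index [simp]:
  "i < dim_vec u \<Longrightarrow> j < dim_vec v \<Longrightarrow> (outer_prod u v) $$ (i, j) = u $ i * v $ j"
  by (simp add: scalar_prod_def)

lemma sbp_carriers:
  assumes "sbp_operator G"
  shows "Hmat G \<in> carrier_mat (npts G) (npts G)" "Amat G \<in> carrier_mat (npts G) (npts G)"
    "dfst G \<in> carrier_vec (npts G)" "dlst G \<in> carrier_vec (npts G)"
    "e_first G \<in> carrier_vec (npts G)" "e_last G \<in> carrier_vec (npts G)"
    "transpose_mat (Hmat G) = Hmat G" "transpose_mat (Amat G) = Amat G"
  using assms by (auto simp: sbp_operator_def sym_pd_def sym_psd_def derivative_approx_def e_first_def e_last_def)

lemma step1_pos: "sbp_operator G \<Longrightarrow> step1 G > 0"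
  by (auto simp: sbp_operator_def step1_def)

lemma Hmat_psd: "sbp_operator G \<Longrightarrow> z \<in> carrier_vec (npts G) \<Longrightarrow> 0 \<le> z \<bullet> (Hmat G *\<^sub>v z)"
  by (cases "z = 0\<^sub>v (npts G)")
    (auto simp: sbp_operator_def sym_pd_def less_imp_le intro!: mult_mat_vec_carrier)

lemma minv_Hmat:
  assumes "sbp_operator G"
  shows "minv (Hmat G) \<in> carrier_mat (npts G) (npts G)" "Hmat G * minv (Hmat G) = 1\<^sub>m (npts G)"
proof -
  have "sym_pd (npts G) (Hmat G)" "diagonal_mat (Hmat G)"
    using assms by (auto simp: sbp_operator_def)
  note minv_diagonal_mat[OF sbp_carriers(1)[OF assms] this(2)] diagonal_pd_entry_pos[OF this(1)]
  then show "minv (Hmat G) \<in> carrier_mat (npts G) (npts G)" "Hmat G * minv (Hmat G) = 1\<^sub>m (npts G)"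
    by force+
qed

lemma minv_H2:
  assumes "sbp_operator G"
  shows "H2 G \<in> carrier_mat (npts G * npts G) (npts G * npts G)"
    "minv (H2 G) \<in> carrier_mat (npts G * npts G) (npts G * npts G)"
    "H2 G * minv (H2 G) = 1\<^sub>m (npts G * npts G)"
proof -
  have pd: "sym_pd (npts G) (Hmat G)" and diag: "diagonal_mat (Hmat G)"
    using assms by (auto simp: sbp_operator_def)
  note H = sbp_carriers(1)[OF assms]
  show car: "H2 G \<in> carrier_mat (npts G * npts G) (npts G * npts G)"
    unfolding H2_def by (rule kron_carrier[OF H H])
  have "diagonal_mat (H2 G)"
    unfolding diagonal_mat_def
  proof (intro allI impI)
    fix i j assume ij: "i < dim_row (H2 G)" "j < dim_col (H2 G)" "i \<noteq> j"
    then have *: "i < npts G * npts G" "j < npts G * npts G" using car by auto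
    have "i div npts G \<noteq> j div npts G \<or> i mod npts G \<noteq> j mod npts G"
      using ij(3) by (metis div_mult_mod_eq)
    moreover have "Hmat G $$ (k, l) = 0" if "k < npts G" "l < npts G" "k \<noteq> l" for k l
      using that diag H unfolding diagonal_mat_def by auto
    ultimately show "H2 G $$ (i, j) = 0"
      using * div_mod_less[OF *(1)] div_mod_less[OF *(2)] H by (auto simp: H2_def)
  qed
  moreover have "H2 G $$ (i, i) \<noteq> 0" if "i < npts G * npts G" for i
    using that div_mod_less[OF that] H diagonal_pd_entry_pos[OF pd, of "i div npts G"]
      diagonal_pd_entry_pos[OF pd, of "i mod npts G"] by (simp add: H2_def)
  ultimately show "minv (H2 G) \<in> carrier_mat (npts G * npts G) (npts G * npts G)"
    "H2 G * minv (H2 G) = 1\<^sub>m (npts G * npts G)"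
    using minv_diagonal_mat[OF car] by auto
qed

lemma Gam_carriers:
  assumes "sbp_operator G"
  shows "e_Gam G \<in> carrier_mat (npts G * npts G) (npts G)" "d_Gam G \<in> carrier_mat (npts G * npts G) (npts G)"
  using sbp_carriers[OF assms] by (auto simp: e_Gam_def d_Gam_def intro!: carrier_matI)

lemma interface_carriers:
  assumes "sbp_operator G" "w \<in> carrier_vec (npts G * npts G)"
  shows "w_Gam G w \<in> carrier_vec (npts G)" "dw_Gam G w \<in> carrier_vec (npts G)"
  using Gam_carriers[OF assms(1)] assms(2) unfolding w_Gam_def dw_Gam_def
  by (auto intro!: mult_mat_vec_carrier)

text \<open>The matrices \<open>1 \<otimes> u\<close> embed data on the interface into the grid. Sandwiching a matrix on the interface
between two of them gives the Kronecker product with a rank one matrix in the normal direction.\<close>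

lemma Gam_factorization:
  assumes "sbp_operator G" and N: "N \<in> carrier_mat (npts G) (npts G)"
    and u: "u \<in> carrier_vec (npts G)" and v: "v \<in> carrier_vec (npts G)"
  shows "(1\<^sub>m (npts G) \<otimes>\<^sub>k col_mat u) * N * transpose_mat (1\<^sub>m (npts G) \<otimes>\<^sub>k col_mat v) = N \<otimes>\<^sub>k outer_prod u v"
proof -
  \<comment> \<open>Writing \<open>N\<close> as a Kronecker product with a \<open>1 \<times> 1\<close> matrix makes the mixed product rule applicable.\<close>
  have N1: "N = N \<otimes>\<^sub>k 1\<^sub>m 1"
    by (rule eq_matI) (use N in \<open>auto simp: kron_def\<close>)
  note c = one_carrier_mat[of "npts G"] one_carrier_mat[of 1] col_mat_carrier[OF u] col_mat_carrier[OF v]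
  have "(1\<^sub>m (npts G) \<otimes>\<^sub>k col_mat u) * N = (1\<^sub>m (npts G) \<otimes>\<^sub>k col_mat u) * (N \<otimes>\<^sub>k 1\<^sub>m 1)"
    using N1 by simp
  also have "\<dots> = N \<otimes>\<^sub>k col_mat u"
    using kron_mult[OF c(1) c(3) N c(2)] left_mult_one_mat[OF N] right_mult_one_mat[OF c(3)] by simp
  finally have "(1\<^sub>m (npts G) \<otimes>\<^sub>k col_mat u) * N = N \<otimes>\<^sub>k col_mat u" .
  moreover have "transpose_mat (col_mat v) \<in> carrier_mat 1 (npts G)" using c(4) by simp
  ultimately show ?thesis
    using kron_mult[OF N c(3) c(1)] right_mult_one_mat[OF N] by (simp add: transpose_kron)
qed

text \<open>The summation-by-parts identity in two dimensions. Multiplication by \<open>H \<otimes> H\<close> cancels the inverse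
norm in each one-dimensional operator and leaves the boundary terms of all four sides. Three of them are
\<open>outer_terms\<close>, the fourth one is the flux through the interface.\<close>

lemma H2_mult_D2_inner:
  assumes "sbp_operator G"
  shows "H2 G * D2_inner G =
    e_Gam G * Hmat G * transpose_mat (d_Gam G) - (Amat G \<otimes>\<^sub>k Hmat G + Hmat G \<otimes>\<^sub>k Amat G)"
proof -
  define n where "n = npts G"
  define X where "X = - Amat G + outer_prod (e_last G) (dlst G) - outer_prod (e_first G) (dfst G)"
  note [simp] = sbp_carriers[OF assms, folded n_def]
  have [simp]: "outer_prod (e_last G) (dlst G) \<in> carrier_mat n n" "outer_prod (e_first G) (dfst G) \<in> carrier_mat n n"
    by (rule outer_prod_carrier; simp)+
  have X [simp]: "X \<in> carrier_mat n n" unfolding X_def by (intro minus_carrier_mat) fact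
  note mH = minv_Hmat[OF assms, folded n_def]
  note mH2 = minv_H2[OF assms, folded n_def]
  have D1 [simp]: "D1 G \<in> carrier_mat n n" using mH X by (auto simp: D1_def X_def[symmetric])
  have HD1: "Hmat G * D1 G = X"
    unfolding D1_def X_def[symmetric]
    using assoc_mult_mat[OF sbp_carriers(1)[OF assms, folded n_def] mH(1) X] mH(2) left_mult_one_mat[OF X] by simp
  have D2c: "D2 G \<in> carrier_mat (n * n) (n * n)"
    unfolding D2_def n_def[symmetric] by (intro add_carrier_mat kron_carrier) auto
  have oc: "outer_terms G \<in> carrier_mat (n * n) (n * n)"
    unfolding outer_terms_def by (intro add_carrier_mat kron_carrier) auto
  have "H2 G * D2 G = X \<otimes>\<^sub>k Hmat G + Hmat G \<otimes>\<^sub>k X"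
  proof -
    have "H2 G * D2 G = H2 G * (D1 G \<otimes>\<^sub>k 1\<^sub>m n) + H2 G * (1\<^sub>m n \<otimes>\<^sub>k D1 G)"
      unfolding D2_def n_def[symmetric]
      by (rule mult_add_distrib_mat[of _ "n * n" "n * n" _ "n * n"]) (use mH2 in \<open>auto intro!: kron_carrier\<close>)
    also have "\<dots> = X \<otimes>\<^sub>k Hmat G + Hmat G \<otimes>\<^sub>k X"
      unfolding H2_def by (simp add: kron_mult[of _ n n _ n n _ n _ n] HD1
          right_mult_one_mat[OF sbp_carriers(1)[OF assms, folded n_def]])
    finally show ?thesis .
  qed
  moreover have "H2 G * (minv (H2 G) * outer_terms G) = outer_terms G"
    using assoc_mult_mat[OF mH2(1,2) oc] mH2(3) left_mult_one_mat[OF oc] by simp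
  moreover have "H2 G * D2_inner G = H2 G * D2 G - H2 G * (minv (H2 G) * outer_terms G)"
    unfolding D2_inner_def
    by (rule mult_minus_distrib_mat[of _ "n * n" "n * n" _ "n * n"]) (use mH2 oc D2c in auto)
  ultimately have 1: "H2 G * D2_inner G = X \<otimes>\<^sub>k Hmat G + Hmat G \<otimes>\<^sub>k X - outer_terms G" by simp
  have 2: "e_Gam G * Hmat G * transpose_mat (d_Gam G) = - (Hmat G \<otimes>\<^sub>k outer_prod (e_first G) (dfst G))"
  proof -
    let ?L = "e_Gam G * Hmat G" and ?d = "1\<^sub>m n \<otimes>\<^sub>k col_mat (dfst G)"
    have "?L * transpose_mat (d_Gam G) = ?L * (- transpose_mat ?d)"
      by (simp add: d_Gam_def transpose_uminus n_def)
    also have "\<dots> = - (?L * transpose_mat ?d)"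
      by (rule uminus_mult_right_mat) (use sbp_carriers[OF assms] Gam_carriers[OF assms] in \<open>simp add: n_def\<close>)
    also have "?L * transpose_mat ?d = Hmat G \<otimes>\<^sub>k outer_prod (e_first G) (dfst G)"
      unfolding e_Gam_def n_def by (rule Gam_factorization[OF assms]) (use sbp_carriers[OF assms] in auto)
    finally show ?thesis .
  qed
  have dims: "dim_row (Hmat G) = n" "dim_col (Hmat G) = n" "dim_row (Amat G) = n" "dim_col (Amat G) = n"
     "dim_vec (dfst G) = n" "dim_vec (dlst G) = n" "dim_vec (e_first G) = n" "dim_vec (e_last G) = n"
    using sbp_carriers[OF assms, folded n_def] by (blast dest: carrier_matD carrier_vecD)+
  show ?thesis unfolding 1 2
  proof (rule eq_matI, goal_cases)
    case (1 i j)
    then have ij: "i < n * n" "j < n * n" by (auto simp: dims)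
    then have "n > 0" by (cases n) auto
    then show ?case
      using ij by (simp add: X_def outer_terms_def dims div_mod_less algebra_simps del: index_mult_mat(1))
  qed (auto simp: dims outer_terms_def)
qed

text \<open>The part \<open>H \<otimes> A\<close> of the stiffness matrix acts along the grid lines normal to the interface. By borrowing, \<open>A\<close> minus
\<open>\<beta> h\<^sub>1\<close> times the square of the first derivative at the interface is still positive semidefinite, since
giving back the square at the other end of the grid line can only increase the form.\<close>

lemma fd_stiffness_bound:
  assumes G: "sbp_operator G" and b: "borrowable G \<beta>" "\<beta> > 0" and w: "w \<in> carrier_vec (npts G * npts G)"
  shows "w \<bullet> ((Amat G \<otimes>\<^sub>k Hmat G + Hmat G \<otimes>\<^sub>k Amat G) *\<^sub>v w)
    \<ge> \<beta> * step1 G * (dw_Gam G w \<bullet> (Hmat G *\<^sub>v dw_Gam G w))"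
proof -
  define n where "n = npts G"
  note c [simp] = sbp_carriers[OF G, folded n_def]
  have w [simp]: "w \<in> carrier_vec (n * n)" using w by (simp add: n_def)
  have H: "sym_pd n (Hmat G)" "diagonal_mat (Hmat G)" and A: "sym_psd n (Amat G)"
    using G by (auto simp: sbp_operator_def n_def)
  let ?O = "outer_prod (dfst G) (dfst G)" and ?L = "outer_prod (dlst G) (dlst G)"
  let ?c = "\<beta> * step1 G"
  have O: "?O \<in> carrier_mat n n" "?L \<in> carrier_mat n n" by (rule outer_prod_carrier; simp)+
  have dims: "dim_row (Hmat G) = n" "dim_col (Hmat G) = n" "dim_row (Amat G) = n" "dim_col (Amat G) = n"
      "dim_vec (dfst G) = n" "dim_vec (dlst G) = n"
    using sbp_carriers[OF G, folded n_def] by (blast dest: carrier_matD carrier_vecD)+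
  have c0: "?c \<ge> 0" using b step1_pos[OF G] by simp
  have outer_psd: "z \<bullet> (outer_prod v v *\<^sub>v z) = (v \<bullet> z)\<^sup>2" if "v \<in> carrier_vec n" "z \<in> carrier_vec n" for v z
    using that by (simp add: scalar_prod_def power2_eq_square sum_product sum_distrib_left mult_ac)
  have psd: "0 \<le> z \<bullet> ((Amat G - ?c \<cdot>\<^sub>m ?O) *\<^sub>v z)" if z: "z \<in> carrier_vec n" for z
  proof -
    have "0 \<le> z \<bullet> ((Amat G - ?c \<cdot>\<^sub>m (?O + ?L)) *\<^sub>v z)"
      using b z by (auto simp: borrowable_def sym_psd_def n_def)
    also have "\<dots> = z \<bullet> ((Amat G - ?c \<cdot>\<^sub>m ?O) *\<^sub>v z) - ?c * (z \<bullet> (?L *\<^sub>v z))"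
      by (simp add: dims carrier_vecD[OF z] mat_diff_vec mat_add_vec mat_smult_vec scalar_prod_diff_right scalar_prod_add_right algebra_simps del: mult_carrier_mat)
    finally show ?thesis using c0 outer_psd[OF c(4) z] by (smt (verit) mult_nonneg_nonneg zero_le_power2)
  qed
  have 1: "0 \<le> w \<bullet> ((Amat G \<otimes>\<^sub>k Hmat G) *\<^sub>v w)"
    by (rule kron_psd_diagonal[OF H, of _ n]) (use A in \<open>auto simp: sym_psd_def\<close>)
  have 2: "0 \<le> w \<bullet> ((Hmat G \<otimes>\<^sub>k (Amat G - ?c \<cdot>\<^sub>m ?O)) *\<^sub>v w)"
    by (rule kron_diagonal_psd[OF H, of _ n]) (use psd O in auto)
  have "Hmat G \<otimes>\<^sub>k (Amat G - ?c \<cdot>\<^sub>m ?O) = Hmat G \<otimes>\<^sub>k Amat G - ?c \<cdot>\<^sub>m (Hmat G \<otimes>\<^sub>k ?O)"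
  proof (rule eq_matI, goal_cases)
    case (1 i j)
    then have ij: "i < n * n" "j < n * n" using c O by auto
    then have "n > 0" by (cases n) auto
    then show ?case using ij by (simp add: dims div_mod_less algebra_simps del: index_mult_mat(1))
  qed (use O c in auto)
  then have "w \<bullet> ((Hmat G \<otimes>\<^sub>k (Amat G - ?c \<cdot>\<^sub>m ?O)) *\<^sub>v w) =
     w \<bullet> ((Hmat G \<otimes>\<^sub>k Amat G) *\<^sub>v w) - ?c * (w \<bullet> ((Hmat G \<otimes>\<^sub>k ?O) *\<^sub>v w))"
    by (simp add: dims carrier_vecD[OF w] mat_diff_vec mat_smult_vec scalar_prod_diff_right)
  moreover have "w \<bullet> ((Hmat G \<otimes>\<^sub>k ?O) *\<^sub>v w) = dw_Gam G w \<bullet> (Hmat G *\<^sub>v dw_Gam G w)"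
  proof -
    let ?d = "1\<^sub>m n \<otimes>\<^sub>k col_mat (dfst G)"
    have d: "?d \<in> carrier_mat (n * n) n" using kron_carrier[OF one_carrier_mat col_mat_carrier[OF c(3)]] by simp
    have dT: "transpose_mat ?d \<in> carrier_mat n (n * n)" using d by simp
    \<comment> \<open>The normal derivative with the sign of the coordinate direction; \<open>dw_Gam\<close> has the opposite sign.\<close>
    define y where "y = transpose_mat ?d *\<^sub>v w"
    have y: "y \<in> carrier_vec n" unfolding y_def by (rule mult_mat_vec_carrier[OF dT w])
    have "w \<bullet> ((Hmat G \<otimes>\<^sub>k ?O) *\<^sub>v w) = w \<bullet> (?d * Hmat G * transpose_mat ?d *\<^sub>v w)"
      using Gam_factorization[OF G] sbp_carriers[OF G] by (simp add: n_def)
    also have "?d * Hmat G * transpose_mat ?d *\<^sub>v w = ?d *\<^sub>v (Hmat G *\<^sub>v y)"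
      unfolding y_def using assoc_mult_mat_vec[OF mult_carrier_mat[OF d c(1)] dT w]
        assoc_mult_mat_vec[OF d c(1) mult_mat_vec_carrier[OF dT w]] by simp
    also have "w \<bullet> \<dots> = y \<bullet> (Hmat G *\<^sub>v y)"
      using scalar_prod_transpose_swap[OF d w mult_mat_vec_carrier[OF c(1) y]]
        comm_scalar_prod[OF y mult_mat_vec_carrier[OF c(1) y]] by (simp add: y_def)
    also have "y = - dw_Gam G w"
      by (simp add: y_def dw_Gam_def d_Gam_def transpose_uminus n_def[symmetric] carrier_vecD[OF w] dims)
    finally show ?thesis
      using carrier_vecD[OF interface_carriers(2)[OF G]] w
      by (simp add: mat_vec_uminus dims n_def[symmetric])
  qed
  moreover have "w \<bullet> ((Amat G \<otimes>\<^sub>k Hmat G + Hmat G \<otimes>\<^sub>k Amat G) *\<^sub>v w) =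
    w \<bullet> ((Amat G \<otimes>\<^sub>k Hmat G) *\<^sub>v w) + w \<bullet> ((Hmat G \<otimes>\<^sub>k Amat G) *\<^sub>v w)"
    by (simp add: dims carrier_vecD[OF w] mat_add_vec scalar_prod_add_right)
  ultimately show ?thesis using 1 2 by (simp add: algebra_simps)
qed

section \<open>Lagrange interpolation\<close>

definition lagrange_poly :: "nat \<Rightarrow> (nat \<Rightarrow> real) \<Rightarrow> nat \<Rightarrow> real poly" where
  "lagrange_poly q t j = (\<Prod>m\<in>{..q} - {j}. Polynomial.smult (1 / (t j - t m)) [:- t m, 1:])"

lemma poly_lagrange_poly:
  "poly (lagrange_poly q t j) x = (\<Prod>m\<in>{..q} - {j}. (x - t m) / (t j - t m))"
  by (simp add: lagrange_poly_def poly_prod diff_divide_distrib)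

lemma lagrange_eq_poly: "lagrange q R k j x = poly (lagrange_poly q (nodes R k) j) x"
  by (simp add: lagrange_def poly_lagrange_poly)

lemma degree_lagrange_poly: "j \<le> q \<Longrightarrow> degree (lagrange_poly q t j) \<le> q"
proof -
  assume j: "j \<le> q"
  have "degree (lagrange_poly q t j) \<le> (\<Sum>m\<in>{..q} - {j}. degree (Polynomial.smult (1 / (t j - t m)) [:- t m, 1:]))"
    unfolding lagrange_poly_def by (rule order_trans[OF degree_prod_sum_le]) (simp_all only: finite_Diff finite_atMost o_def order_refl)
  also have "\<dots> \<le> (\<Sum>m\<in>{..q} - {j}. 1)"
    by (intro sum_mono order_trans[OF degree_smult_le]) simp
  also have "\<dots> = q" using j by simp
  finally show ?thesis .
qed

lemma lagrange_poly_at_node: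
  assumes "inj_on t {..q}" "i \<le> q" "j \<le> q"
  shows "poly (lagrange_poly q t j) (t i) = (if i = j then 1 else 0)"
proof (cases "i = j")
  case True
  then have "t j - t m \<noteq> 0" if "m \<in> {..q} - {j}" for m
    using assms that by (auto dest: inj_onD)
  with True show ?thesis by (simp add: poly_lagrange_poly)
next
  case False
  then have "i \<in> {..q} - {j}" using assms by auto
  then show ?thesis using False by (auto simp: poly_lagrange_poly intro!: prod_zero)
qed

text \<open>Both sides are polynomials of degree at most \<open>q\<close> that agree at \<open>q + 1\<close> nodes.\<close>

lemma lagrange_interpolation:
  assumes t: "inj_on t {..q}" and p: "degree p \<le> q"
  shows "poly p x = (\<Sum>j\<le>q. poly p (t j) * poly (lagrange_poly q t j) x)"
proof -
  let ?r = "\<Sum>j\<le>q. Polynomial.smult (poly p (t j)) (lagrange_poly q t j)"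
  have "p = ?r"
  proof (rule poly_eqI_degree)
    show "card (t ` {..q}) > degree p" "card (t ` {..q}) > degree ?r"
      using p by (auto simp: card_image[OF t] less_Suc_eq_le intro!: degree_sum_le
          order_trans[OF degree_smult_le degree_lagrange_poly])
    show "poly p x = poly ?r x" if "x \<in> t ` {..q}" for x
    proof -
      from that obtain i where i: "i \<le> q" "x = t i" by auto
      have "poly ?r x = (\<Sum>j\<le>q. if i = j then poly p (t j) else 0)"
        unfolding poly_sum by (rule sum.cong) (use i lagrange_poly_at_node[OF t] in auto)
      then show ?thesis using i by simp
    qed
  qed
  then have "poly p x = poly ?r x" by simp
  then show ?thesis by (simp add: poly_sum)
qed

section \<open>A tensor product basis for polynomials in two variables\<close>

abbreviation unit_lagrange :: "nat \<Rightarrow> nat \<Rightarrow> real poly" where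
  "unit_lagrange q \<equiv> lagrange_poly q real"

text \<open>The nodes are the integer points \<open>{0..q}\<^sup>2\<close>. They need not lie in the element: a polynomial on
an element is identified with its extension to the plane, and the degree of the basis functions may exceed
\<open>q\<close> because they only serve as fixed coefficient functions.\<close>

definition tensor_lagrange :: "nat \<Rightarrow> nat \<times> nat \<Rightarrow> point \<Rightarrow> real" where
  "tensor_lagrange q i z = poly (unit_lagrange q (fst i)) (fst z) * poly (unit_lagrange q (snd i)) (snd z)"

definition tensor_lagrange_grad :: "nat \<Rightarrow> nat \<times> nat \<Rightarrow> point \<Rightarrow> point" where
  "tensor_lagrange_grad q i z =
    (poly (pderiv (unit_lagrange q (fst i))) (fst z) * poly (unit_lagrange q (snd i)) (snd z),
     poly (unit_lagrange q (fst i)) (fst z) * poly (pderiv (unit_lagrange q (snd i))) (snd z))"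

definition lattice_pt :: "nat \<times> nat \<Rightarrow> point" where
  "lattice_pt i = (real (fst i), real (snd i))"

text \<open>A polynomial of total degree at most \<open>q\<close> has degree at most \<open>q\<close> in each variable, so one-dimensional
interpolation applies first in \<open>x\<close> and then in \<open>y\<close>.\<close>

lemma polys_tensor_expansion:
  assumes "p \<in> polys q"
  shows "p z = (\<Sum>i\<in>{..q}\<times>{..q}. p (lattice_pt i) * tensor_lagrange q i z)"
proof -
  obtain c where c: "p (x, y) = (\<Sum>a\<le>q. \<Sum>b\<le>q - a. c a b * x ^ a * y ^ b)" for x y
    using assms by (auto simp: polys_def)
  have inj: "inj_on real {..q}" by (simp add: inj_on_def)
  have X: "p (x, y) = (\<Sum>a\<le>q. p (real a, y) * poly (unit_lagrange q a) x)" for x y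
  proof -
    define f where "f = (\<Sum>a\<le>q. monom (\<Sum>b\<le>q - a. c a b * y ^ b) a)"
    have "degree f \<le> q" unfolding f_def
      by (intro degree_sum_le) (auto intro: order_trans[OF degree_monom_le])
    moreover have "poly f x = p (x, y)" for x
      by (simp add: f_def c poly_sum poly_monom sum_distrib_left mult_ac)
    ultimately show ?thesis using lagrange_interpolation[OF inj, of f x] by simp
  qed
  have Y: "p (x, y) = (\<Sum>b\<le>q. p (x, real b) * poly (unit_lagrange q b) y)" for x y
  proof -
    define f where "f = (\<Sum>a\<le>q. \<Sum>b\<le>q - a. monom (c a b * x ^ a) b)"
    have "degree f \<le> q" unfolding f_def
      by (intro degree_sum_le) (auto intro: order_trans[OF degree_monom_le])
    moreover have "poly f y = p (x, y)" for y
      by (simp add: f_def c poly_sum poly_monom)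
    ultimately show ?thesis using lagrange_interpolation[OF inj, of f y] by simp
  qed
  obtain x y where z: "z = (x, y)" by force
  have "p (x, y) = (\<Sum>a\<le>q. p (real a, y) * poly (unit_lagrange q a) x)" by (rule X)
  also have "\<dots> = (\<Sum>a\<le>q. (\<Sum>b\<le>q. p (real a, real b) * poly (unit_lagrange q b) y) * poly (unit_lagrange q a) x)"
    by (intro sum.cong refl arg_cong2[where f = "(*)"] Y)
  also have "\<dots> = (\<Sum>i\<in>{..q}\<times>{..q}. p (lattice_pt i) * tensor_lagrange q i z)"
    by (simp add: sum.cartesian_product case_prod_unfold z sum_distrib_left sum_distrib_right lattice_pt_def tensor_lagrange_def mult_ac)
  finally show ?thesis by (simp add: z)
qed

text \<open>Gradients are unique, so the definite description in \<open>grad\<close> is resolved by any gradient.\<close>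

lemma gderiv_grad: "GDERIV p z :> g \<Longrightarrow> grad p z = g"
  unfolding grad_def
proof (rule the_equality)
  fix g' assume g: "GDERIV p z :> g" and g': "GDERIV p z :> g'"
  have "(\<lambda>h. inner h g) = (\<lambda>h. inner h g')"
    using g g' unfolding gderiv_def by (rule has_derivative_unique)
  then have "inner (g' - g) g = inner (g' - g) g'" by metis
  then have "inner (g' - g) (g' - g) = 0" by (simp add: inner_diff_right)
  then show "g' = g" by simp
qed

lemma GDERIV_tensor_lagrange: "GDERIV (tensor_lagrange q i) z :> tensor_lagrange_grad q i z"
proof -
  have *: "((\<lambda>z. poly f (g z)) has_derivative (\<lambda>h. g h * poly (pderiv f) (g z))) (at z)"
    if "bounded_linear g" for f and g :: "point \<Rightarrow> real" and z
    using has_derivative_compose[OF bounded_linear_imp_has_derivative[OF that]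
        poly_DERIV[of f "g z", unfolded has_field_derivative_def]] by (simp add: mult.commute)
  show ?thesis
    unfolding gderiv_def tensor_lagrange_def[abs_def] tensor_lagrange_grad_def
    by (rule has_derivative_eq_rhs[OF has_derivative_mult[OF *[OF bounded_linear_fst] *[OF bounded_linear_snd]]])
      (auto simp: inner_prod_def algebra_simps)
qed

lemma grad_tensor_expansion:
  assumes "p \<in> polys q"
  shows "grad p z = (\<Sum>i\<in>{..q}\<times>{..q}. p (lattice_pt i) *\<^sub>R tensor_lagrange_grad q i z)"
proof (rule gderiv_grad)
  have "GDERIV (\<lambda>z. \<Sum>i\<in>{..q}\<times>{..q}. p (lattice_pt i) * tensor_lagrange q i z) z
     :> (\<Sum>i\<in>{..q}\<times>{..q}. p (lattice_pt i) *\<^sub>R tensor_lagrange_grad q i z)"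
    unfolding gderiv_def inner_sum_right inner_scaleR_right
    by (intro has_derivative_sum has_derivative_mult_right)
      (use GDERIV_tensor_lagrange in \<open>auto simp: gderiv_def\<close>)
  then show "GDERIV p z :> (\<Sum>i\<in>{..q}\<times>{..q}. p (lattice_pt i) *\<^sub>R tensor_lagrange_grad q i z)"
    by (subst (asm) polys_tensor_expansion[OF assms, symmetric]) 
qed

lemma continuous_tensor_lagrange:
  "continuous_on S (tensor_lagrange q i)" "continuous_on S (tensor_lagrange_grad q i)"
  unfolding tensor_lagrange_def[abs_def] tensor_lagrange_grad_def[abs_def]
  by (intro continuous_intros)+

text \<open>On the line \<open>y = 0\<close> the tensor basis reduces to multiples of Lagrange polynomials in \<open>x\<close>.
The normal derivative differentiates only the \<open>y\<close> factors, so the degree in \<open>x\<close> does not exceed \<open>q\<close>.\<close>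

lemma polys_bottom:
  assumes "p \<in> polys q"
  shows "\<exists>f. degree f \<le> q \<and> (\<forall>x. p (x, 0) = poly f x)"
    "\<exists>f. degree f \<le> q \<and> (\<forall>x. inner (grad p (x, 0)) (0, 1) = poly f x)"
proof -
  let ?f = "\<lambda>r. \<Sum>i\<in>{..q}\<times>{..q}. Polynomial.smult (p (lattice_pt i) * poly (r (unit_lagrange q (snd i))) 0) (unit_lagrange q (fst i))"
  have "degree (?f r) \<le> q" for r
    by (intro degree_sum_le) (auto intro: degree_lagrange_poly)
  moreover have "p (x, 0) = poly (?f id) x" for x
    by (subst polys_tensor_expansion[OF assms]) (simp add: poly_sum tensor_lagrange_def mult_ac)
  moreover have "inner (grad p (x, 0)) (0, 1) = poly (?f pderiv) x" for x
    by (simp add: grad_tensor_expansion[OF assms] poly_sum tensor_lagrange_grad_def inner_sum_left mult_ac)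
  ultimately show "\<exists>f. degree f \<le> q \<and> (\<forall>x. p (x, 0) = poly f x)"
    "\<exists>f. degree f \<le> q \<and> (\<forall>x. inner (grad p (x, 0)) (0, 1) = poly f x)" by blast+
qed

section \<open>Integrals of finite expansions\<close>

text \<open>Stated for vector-valued functions on a Euclidean space, so that it covers values and gradients on an
element as well as functions on a face.\<close>

lemma integral_inner_sums:
  fixes F :: "'i \<Rightarrow> 'a::euclidean_space \<Rightarrow> 'b::real_inner"
  assumes K: "compact K" and I: "finite I" and F: "\<And>i. i \<in> I \<Longrightarrow> continuous_on K (F i)"
  shows "(LINT z:K|lborel. inner (\<Sum>i\<in>I. a i *\<^sub>R F i z) (\<Sum>j\<in>I. b j *\<^sub>R F j z)) =
    (\<Sum>i\<in>I. \<Sum>j\<in>I. a i * b j * (LINT z:K|lborel. inner (F i z) (F j z)))"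
proof -
  have int: "set_integrable lborel K (\<lambda>z. inner (F i z) (F j z))" if "i \<in> I" "j \<in> I" for i j
    unfolding set_integrable_def by (rule borel_integrable_compact[OF K]) (intro continuous_on_inner F that)
  have int': "integrable lborel (\<lambda>z. a i * b j * (indicator K z *\<^sub>R inner (F i z) (F j z)))"
    if "i \<in> I" "j \<in> I" for i j
    using int[OF that] unfolding set_integrable_def by (rule integrable_mult_right)
  have "(LINT z:K|lborel. inner (\<Sum>i\<in>I. a i *\<^sub>R F i z) (\<Sum>j\<in>I. b j *\<^sub>R F j z)) =
     (LINT z|lborel. (\<Sum>i\<in>I. \<Sum>j\<in>I. a i * b j * (indicator K z *\<^sub>R inner (F i z) (F j z))))"
    unfolding set_lebesgue_integral_def inner_sum_left
    by (simp add: inner_sum_right mult_ac sum_distrib_left)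
  also have "\<dots> = (\<Sum>i\<in>I. \<Sum>j\<in>I. (LINT z|lborel. a i * b j * (indicator K z *\<^sub>R inner (F i z) (F j z))))"
    using int' by (subst Bochner_Integration.integral_sum; auto intro!: sum.cong Bochner_Integration.integral_sum Bochner_Integration.integrable_sum)
  finally show ?thesis unfolding set_lebesgue_integral_def by simp
qed

section \<open>The mesh\<close>

lemma elem_compact:
  assumes "dg_discretization q R" "K \<in> elems R"
  shows "compact K"
proof -
  have "2 simplex K" using assms by (auto simp: dg_discretization_def triangulates_def)
  then show ?thesis by (rule compact_simplex)
qed

lemma faces_in_elems:
  assumes "dg_discretization q R" "k < nfaces R"
  shows "faces R ! k \<in> elems R"
proof -
  have "faces R ! k \<in> set (faces R)" using assms(2) by (simp add: nfaces_def)
  then show ?thesis using assms(1) by (auto simp: dg_discretization_def interface_elems_def)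
qed

lemma face_coords_compact:
  assumes "dg_discretization q R" "k < nfaces R"
  shows "compact (face_coords R k)"
proof -
  have "compact Gam" unfolding Gam_def Omega1_def Omega2_def
    by (intro compact_Int compact_Times compact_Icc)
  then have "compact (faces R ! k \<inter> Gam)"
    using elem_compact[OF assms(1) faces_in_elems[OF assms]] by (blast intro: compact_Int)
  then have "compact (fst ` (faces R ! k \<inter> Gam))"
    by (rule compact_continuous_image[OF continuous_on_fst[OF continuous_on_id]])
  moreover have "face_coords R k = fst ` (faces R ! k \<inter> Gam)"
    by (force simp: face_coords_def Gam_def Omega1_def Omega2_def)
  ultimately show ?thesis by simp
qed

text \<open>A triangle has two different vertices. Positivity is needed since the penalties divide by the mesh size.\<close>

lemma mesh_size_pos:
  assumes "dg_discretization q R"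
  shows "mesh_size R > 0"
proof -
  have tri: "triangulation (elems R)" "\<Union>(elems R) = Omega2" "\<And>K. K \<in> elems R \<Longrightarrow> 2 simplex K"
    using assms by (auto simp: dg_discretization_def triangulates_def)
  have fin: "finite (elems R)" using tri(1) by (auto simp: triangulation_def)
  have "(0, 0) \<in> Omega2" by (auto simp: Omega2_def)
  then obtain K where K: "K \<in> elems R" using tri(2) by blast
  obtain C where C: "finite C" "card C = 3" "K = convex hull C"
    using tri(3)[OF K] by (auto simp: simplex)
  then obtain x y where xy: "x \<in> C" "y \<in> C" "x \<noteq> y"
    by (metis card.empty card_1_singletonE card_le_Suc0_iff_eq le_SucI numeral_3_eq_3 not_less_eq_eq order_refl)
  have "0 < dist x y" using xy by simp
  also have "\<dots> \<le> diameter K"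
    by (rule diameter_bounded_bound) (use C xy elem_compact[OF assms K] in \<open>auto simp: hull_inc compact_imp_bounded\<close>)
  also have "\<dots> \<le> mesh_size R"
    unfolding mesh_size_def using K fin by (intro Max_ge) auto
  finally show ?thesis .
qed

section \<open>Face integrals in terms of Lagrange coefficients\<close>

lemma u_Gam_carrier: "u_Gam q R u \<in> carrier_vec (ndof q R)" "uy_Gam q R u \<in> carrier_vec (ndof q R)"
  by (auto simp: u_Gam_def uy_Gam_def lagrange_coeffs_def)



lemma face_fun_diff:
  assumes "c \<in> carrier_vec (ndof q R)" "d \<in> carrier_vec (ndof q R)" "k < nfaces R"
  shows "face_fun q R (c - d) k x = face_fun q R c k x - face_fun q R d k x"
proof -
  have "k * (q + 1) + j < ndof q R" if "j \<le> q" for j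
    unfolding ndof_def by (rule block_index_less) (use assms that in auto)
  then show ?thesis using assms
    by (simp add: face_fun_def left_diff_distrib sum_subtractf)
qed

lemma face_fun_smult:
  assumes "c \<in> carrier_vec (ndof q R)" "k < nfaces R"
  shows "face_fun q R (a \<cdot>\<^sub>v c) k x = a * face_fun q R c k x"
proof -
  have "k * (q + 1) + j < ndof q R" if "j \<le> q" for j
    unfolding ndof_def by (rule block_index_less) (use assms that in auto)
  then show ?thesis using assms
    by (simp add: face_fun_def sum_distrib_left mult_ac)
qed

lemma face_inner_expansion:
  assumes "dg_discretization q R" "k < nfaces R"
  shows "face_inner R k (face_fun q R c k) (face_fun q R d k) =
    (\<Sum>i\<le>q. \<Sum>j\<le>q. c $ (k * (q + 1) + i) * d $ (k * (q + 1) + j) *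
       face_inner R k (lagrange q R k i) (lagrange q R k j))"
proof -
  have "continuous_on S (lagrange q R k i)" for S i
    unfolding lagrange_eq_poly[abs_def] by (intro continuous_intros)
  then show ?thesis
    using integral_inner_sums[OF face_coords_compact[OF assms] finite_atMost[of q],
        of "lagrange q R k" "\<lambda>i. c $ (k * (q + 1) + i)" "\<lambda>j. d $ (k * (q + 1) + j)"]
    by (simp only: face_inner_def face_fun_def inner_real_def real_scaleR_def simp_thms)
qed

lemma Mmat_carrier: "Mmat q R \<in> carrier_mat (ndof q R) (ndof q R)"
  by (simp add: Mmat_def)

lemma Mmat_symmetric: "transpose_mat (Mmat q R) = Mmat q R"
  by (rule eq_matI) (auto simp: Mmat_def face_inner_def mult.commute)

text \<open>The mass matrix is block diagonal with one block for each face, so the double sum over all coefficients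
collapses to pairs of coefficients on the same face.\<close>

lemma sum_face_inner_eq_Mmat:
  assumes R: "dg_discretization q R"
    and c: "c \<in> carrier_vec (ndof q R)" and d: "d \<in> carrier_vec (ndof q R)"
  shows "(\<Sum>k<nfaces R. face_inner R k (face_fun q R c k) (face_fun q R d k)) = c \<bullet> (Mmat q R *\<^sub>v d)"
proof -
  define Q where "Q = q + 1"
  define F where "F k i l j = (if k = l then c $ (k * Q + i) * d $ (l * Q + j) *
      face_inner R k (lagrange q R k i) (lagrange q R l j) else 0)" for k i l j
  have F_eq: "F (a div Q) (a mod Q) (b div Q) (b mod Q) = c $ a * ((if a div Q = b div Q
      then face_inner R (a div Q) (lagrange q R (a div Q) (a mod Q)) (lagrange q R (b div Q) (b mod Q))
      else 0) * d $ b)" for a b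
    unfolding F_def div_mult_mod_eq by simp
  have "c \<bullet> (Mmat q R *\<^sub>v d) =
     (\<Sum>a<nfaces R * Q. \<Sum>b<nfaces R * Q. F (a div Q) (a mod Q) (b div Q) (b mod Q))"
    unfolding Mmat_def ndof_def Q_def[symmetric] using c[unfolded ndof_def Q_def[symmetric]] d[unfolded ndof_def Q_def[symmetric]]
    by (simp add: F_eq scalar_prod_def lessThan_atLeast0 sum_distrib_left)
  also have "\<dots> = (\<Sum>a<nfaces R * Q. \<Sum>l<nfaces R. \<Sum>j<Q. F (a div Q) (a mod Q) l j)"
    by (intro sum.cong refl sum_div_mod)
  also have "\<dots> = (\<Sum>k<nfaces R. \<Sum>i<Q. \<Sum>l<nfaces R. \<Sum>j<Q. F k i l j)"
    by (rule sum_div_mod[of "\<lambda>k i. \<Sum>l<nfaces R. \<Sum>j<Q. F k i l j"])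
  also have "\<dots> = (\<Sum>k<nfaces R. \<Sum>i<Q. \<Sum>j<Q. F k i k j)"
  proof (rule sum.cong[OF refl], rule sum.cong[OF refl])
    fix k i assume "k \<in> {..<nfaces R}"
    moreover have "(\<Sum>l<nfaces R. \<Sum>j<Q. F k i l j) = (\<Sum>l<nfaces R. if l = k then \<Sum>j<Q. F k i k j else 0)"
      by (intro sum.cong) (auto simp: F_def)
    ultimately show "(\<Sum>l<nfaces R. \<Sum>j<Q. F k i l j) = (\<Sum>j<Q. F k i k j)" by simp
  qed
  also have "\<dots> = (\<Sum>k<nfaces R. face_inner R k (face_fun q R c k) (face_fun q R d k))"
  proof (rule sum.cong[OF refl])
    fix k assume "k \<in> {..<nfaces R}"
    moreover have "{..q} = {..<Q}" by (auto simp: Q_def)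
    ultimately show "(\<Sum>i<Q. \<Sum>j<Q. F k i k j) = face_inner R k (face_fun q R c k) (face_fun q R d k)"
      using face_inner_expansion[OF R, of k c d, folded Q_def] by (simp add: F_def)
  qed
  finally show ?thesis by simp
qed

lemma Mmat_psd:
  assumes "dg_discretization q R" "z \<in> carrier_vec (ndof q R)"
  shows "0 \<le> z \<bullet> (Mmat q R *\<^sub>v z)"
  unfolding sum_face_inner_eq_Mmat[OF assms assms(2), symmetric] face_inner_def set_lebesgue_integral_def
  by (intro sum_nonneg integral_nonneg_AE) auto

lemma face_fun_lagrange_coeffs:
  assumes R: "dg_discretization q R" and k: "k < nfaces R"
    and f: "degree f \<le> q" "\<And>x. p k x = poly f x"
  shows "face_fun q R (lagrange_coeffs q R p) k x = p k x"
proof -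
  have inj: "inj_on (nodes R k) {..q}" using R k by (auto simp: dg_discretization_def)
  have "lagrange_coeffs q R p $ (k * (q + 1) + j) = poly f (nodes R k j)" if j: "j \<le> q" for j
  proof -
    have idx: "k * (q + 1) + j < ndof q R"
      unfolding ndof_def by (rule block_index_less) (use k j in auto)
    have "(k * (q + 1) + j) div (q + 1) = k" "(k * (q + 1) + j) mod (q + 1) = j"
      using j by (simp_all only: div_mult_self3 mod_mult_self3) simp_all
    then show ?thesis unfolding lagrange_coeffs_def index_vec[OF idx] by (simp only: f(2))
  qed
  then have "face_fun q R (lagrange_coeffs q R p) k x = (\<Sum>j\<le>q. poly f (nodes R k j) * poly (lagrange_poly q (nodes R k) j) x)"
    unfolding face_fun_def lagrange_eq_poly by (intro sum.cong refl) (simp only: atMost_iff)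
  then show ?thesis
    using lagrange_interpolation[OF inj f(1), of x] by (simp only: f(2))
qed

text \<open>Traces of functions in the Galerkin space are polynomials of degree at most \<open>q\<close> on each face, so the
Lagrange coefficients determine them. This turns the face integrals of the scheme and of the trace inequality
into forms of the mass matrix.\<close>

lemma traces_eq_face_fun:
  assumes R: "dg_discretization q R" and k: "k < nfaces R" and u: "u \<in> DG_space q (elems R)"
  shows "trace R u k = face_fun q R (u_Gam q R u) k" "normal_deriv R u k = face_fun q R (uy_Gam q R u) k"
proof -
  have p: "u (faces R ! k) \<in> polys q" using u faces_in_elems[OF R k] by (auto simp: DG_space_def)
  obtain f where f: "degree f \<le> q" "\<And>x. trace R u k x = poly f x"
    using polys_bottom(1)[OF p] by (auto simp: trace_def)
  obtain g where g: "degree g \<le> q" "\<And>x. normal_deriv R u k x = poly g x"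
    using polys_bottom(2)[OF p] by (auto simp: normal_deriv_def)
  show "trace R u k = face_fun q R (u_Gam q R u) k"
    unfolding u_Gam_def using face_fun_lagrange_coeffs[OF R k f(1), of "trace R u", OF f(2)] by auto
  show "normal_deriv R u k = face_fun q R (uy_Gam q R u) k"
    unfolding uy_Gam_def using face_fun_lagrange_coeffs[OF R k g(1), of "normal_deriv R u", OF g(2)] by auto
qed

text \<open>The last penalty of the scheme contains \<open>u\<close> after a round trip through the grid minus the projected grid
values, which is minus the projection of the jump \<open>r\<close> that the finite difference scheme sees.\<close>

lemma dg_rhs_eq_Mmat:
  assumes R: "dg_discretization q R" and u: "u \<in> DG_space q (elems R)" and \<phi>: "\<phi> \<in> DG_space q (elems R)"
    and P: "norm_compatible q G R P" and G: "sbp_operator G" and w: "w \<in> carrier_vec (npts G * npts G)"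
  defines "s \<equiv> u_Gam q R u - Pg_wu P *\<^sub>v w_Gam G w"
    and "r \<equiv> w_Gam G w - Pg_uw P *\<^sub>v u_Gam q R u"
  shows "dg_rhs \<pi> q G R P w u \<phi> =
     - (b2 \<pi> * dg_grad_inner R u \<phi>)
     + 1/2 * b2 \<pi> * (s \<bullet> (Mmat q R *\<^sub>v uy_Gam q R \<phi>))
     + 1/2 * (b2 \<pi> * (uy_Gam q R u \<bullet> (Mmat q R *\<^sub>v u_Gam q R \<phi>))
               - b1 \<pi> * ((Pb_wu P *\<^sub>v dw_Gam G w) \<bullet> (Mmat q R *\<^sub>v u_Gam q R \<phi>)))
     - tau_u \<pi> / mesh_size R * b2 \<pi> * (s \<bullet> (Mmat q R *\<^sub>v u_Gam q R \<phi>))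
     + sigma_u \<pi> / step1 G * b1 \<pi> * ((Pb_wu P *\<^sub>v r) \<bullet> (Mmat q R *\<^sub>v u_Gam q R \<phi>))"
proof -
  have Pc: "Pg_uw P \<in> carrier_mat (npts G) (ndof q R)" "Pg_wu P \<in> carrier_mat (ndof q R) (npts G)"
      "Pb_wu P \<in> carrier_mat (ndof q R) (npts G)"
    using P by (auto simp: norm_compatible_def)
  note wc = interface_carriers[OF G w]
  note uc = u_Gam_carrier[of q R]
  define a where "a = Pg_wu P *\<^sub>v w_Gam G w"
  define b where "b = Pb_wu P *\<^sub>v dw_Gam G w"
  define c where "c = Pb_wu P *\<^sub>v (Pg_uw P *\<^sub>v u_Gam q R u)"
  define d where "d = Pb_wu P *\<^sub>v w_Gam G w"
  have car: "a \<in> carrier_vec (ndof q R)" "b \<in> carrier_vec (ndof q R)" "c \<in> carrier_vec (ndof q R)" "d \<in> carrier_vec (ndof q R)"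
    using Pc wc uc by (auto simp: a_def b_def c_def d_def intro!: mult_mat_vec_carrier)
  have "Pb_wu P *\<^sub>v r = d - c"
    unfolding r_def c_def d_def
    by (rule mat_vec_diff) (use Pc carrier_vecD[OF wc(1)] in auto)
  then have cd: "c - d = - (Pb_wu P *\<^sub>v r)"
    using car by (intro eq_vecI) auto
  have conv: "(\<Sum>k<nfaces R. face_inner R k (\<lambda>x. face_fun q R e k x - face_fun q R f k x) (face_fun q R g k))
      = (e - f) \<bullet> (Mmat q R *\<^sub>v g)"
    if "e \<in> carrier_vec (ndof q R)" "f \<in> carrier_vec (ndof q R)" "g \<in> carrier_vec (ndof q R)" for e f g
    using that sum_face_inner_eq_Mmat[OF R minus_carrier_vec[OF that(1,2)] that(3)]
    by (simp add: face_fun_diff[OF that(1,2), symmetric])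
  define U where "U = u_Gam q R u"
  define Uy where "Uy = uy_Gam q R u"
  define V where "V = u_Gam q R \<phi>"
  define Vy where "Vy = uy_Gam q R \<phi>"
  have Uc: "U \<in> carrier_vec (ndof q R)" "Uy \<in> carrier_vec (ndof q R)"
      "V \<in> carrier_vec (ndof q R)" "Vy \<in> carrier_vec (ndof q R)"
    unfolding U_def Uy_def V_def Vy_def by (rule uc)+
  let ?f = "face_fun q R"
  have "(\<Sum>k<nfaces R. 1/2 * b2 \<pi> * face_inner R k (\<lambda>x. trace R u k x - ?f a k x) (normal_deriv R \<phi> k)
            + 1/2 * face_inner R k (\<lambda>x. b2 \<pi> * normal_deriv R u k x - b1 \<pi> * ?f b k x) (trace R \<phi> k))
    = (\<Sum>k<nfaces R. 1/2 * b2 \<pi> * face_inner R k (\<lambda>x. ?f U k x - ?f a k x) (?f Vy k)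
            + 1/2 * face_inner R k (\<lambda>x. ?f (b2 \<pi> \<cdot>\<^sub>v Uy) k x - ?f (b1 \<pi> \<cdot>\<^sub>v b) k x) (?f V k))"
    by (intro sum.cong refl) (simp add: traces_eq_face_fun[OF R _ u] traces_eq_face_fun[OF R _ \<phi>]
        U_def Uy_def V_def Vy_def face_fun_smult uc car)
  also have "\<dots> = 1/2 * b2 \<pi> * ((U - a) \<bullet> (Mmat q R *\<^sub>v Vy))
       + 1/2 * ((b2 \<pi> \<cdot>\<^sub>v Uy - b1 \<pi> \<cdot>\<^sub>v b) \<bullet> (Mmat q R *\<^sub>v V))"
    unfolding sum.distrib sum_distrib_left[symmetric] by (simp add: conv Uc car)
  finally have 1: "(\<Sum>k<nfaces R. 1/2 * b2 \<pi> * face_inner R k (\<lambda>x. trace R u k x - ?f a k x) (normal_deriv R \<phi> k)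
            + 1/2 * face_inner R k (\<lambda>x. b2 \<pi> * normal_deriv R u k x - b1 \<pi> * ?f b k x) (trace R \<phi> k))
    = 1/2 * b2 \<pi> * ((U - a) \<bullet> (Mmat q R *\<^sub>v Vy))
       + 1/2 * ((b2 \<pi> \<cdot>\<^sub>v Uy - b1 \<pi> \<cdot>\<^sub>v b) \<bullet> (Mmat q R *\<^sub>v V))" .
  have "(\<Sum>k<nfaces R. tau_u \<pi> / mesh_size R * b2 \<pi> * face_inner R k (\<lambda>x. trace R u k x - ?f a k x) (trace R \<phi> k)
            + sigma_u \<pi> / step1 G * b1 \<pi> * face_inner R k (\<lambda>x. ?f c k x - ?f d k x) (trace R \<phi> k))
    = (\<Sum>k<nfaces R. tau_u \<pi> / mesh_size R * b2 \<pi> * face_inner R k (\<lambda>x. ?f U k x - ?f a k x) (?f V k)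
            + sigma_u \<pi> / step1 G * b1 \<pi> * face_inner R k (\<lambda>x. ?f c k x - ?f d k x) (?f V k))"
    by (intro sum.cong refl) (simp add: traces_eq_face_fun[OF R _ u] traces_eq_face_fun[OF R _ \<phi>] U_def V_def)
  also have "\<dots> = tau_u \<pi> / mesh_size R * b2 \<pi> * ((U - a) \<bullet> (Mmat q R *\<^sub>v V))
       + sigma_u \<pi> / step1 G * b1 \<pi> * ((c - d) \<bullet> (Mmat q R *\<^sub>v V))"
    unfolding sum.distrib sum_distrib_left[symmetric] by (simp add: conv Uc car)
  finally have 2: "(\<Sum>k<nfaces R. tau_u \<pi> / mesh_size R * b2 \<pi> * face_inner R k (\<lambda>x. trace R u k x - ?f a k x) (trace R \<phi> k)
            + sigma_u \<pi> / step1 G * b1 \<pi> * face_inner R k (\<lambda>x. ?f c k x - ?f d k x) (trace R \<phi> k))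
    = tau_u \<pi> / mesh_size R * b2 \<pi> * ((U - a) \<bullet> (Mmat q R *\<^sub>v V))
       + sigma_u \<pi> / step1 G * b1 \<pi> * ((c - d) \<bullet> (Mmat q R *\<^sub>v V))" .
  have dims: "dim_row (Mmat q R) = ndof q R" "dim_vec Uy = ndof q R" "dim_vec b = ndof q R" "dim_row (Pb_wu P) = ndof q R"
    using Uc car Pc by (auto simp: Mmat_def)
  show ?thesis
    unfolding dg_rhs_def Let_def a_def[symmetric] b_def[symmetric] c_def[symmetric] d_def[symmetric] 1 2 cd
    unfolding s_def a_def[symmetric] U_def[symmetric] Uy_def[symmetric] V_def[symmetric] Vy_def[symmetric] b_def[symmetric]
    by (simp add: scalar_prod_diff_left scalar_prod_smult_left dims algebra_simps)
qed

section \<open>Signs of the two energy contributions\<close>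

text \<open>Young's inequality is used with the parameter \<open>\<beta> h\<^sub>1\<close>, so that the square of the normal derivative has
exactly the weight that the stiffness form dominates. The remaining weight of the squared jump is
\<open>1 / (4 \<beta> h\<^sub>1)\<close>, which the penalty dominates.\<close>

lemma E1_nonpos:
  assumes G: "sbp_operator G" and b: "borrowing_capacity G \<beta>" and \<tau>: "tau_w \<pi> \<ge> 1 / (4 * \<beta>)"
    and b1: "b1 \<pi> > 0" and P: "Pg_uw P \<in> carrier_mat (npts G) (ndof q R)"
    and w: "w \<in> carrier_vec (npts G * npts G)"
  shows "E1 \<pi> q G R P w u \<le> 0"
proof -
  define r where "r = w_Gam G w - Pg_uw P *\<^sub>v u_Gam q R u"
  define S where "S = w \<bullet> ((Amat G \<otimes>\<^sub>k Hmat G + Hmat G \<otimes>\<^sub>k Amat G) *\<^sub>v w)"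
  note c = sbp_carriers[OF G]
  have r: "r \<in> carrier_vec (npts G)"
    using interface_carriers(1)[OF G w] mult_mat_vec_carrier[OF P u_Gam_carrier(1)] by (simp add: r_def)
  note d = interface_carriers(2)[OF G w]
  have \<beta>: "\<beta> > 0" and h: "step1 G > 0" using b step1_pos[OF G] by (auto simp: borrowing_capacity_def)
  have "dw_Gam G w \<bullet> (Hmat G *\<^sub>v r) = r \<bullet> (Hmat G *\<^sub>v dw_Gam G w)"
    by (rule symmetric_form_commute[OF c(1,7) d r])
  also have "\<dots> \<le> \<beta> * step1 G * (dw_Gam G w \<bullet> (Hmat G *\<^sub>v dw_Gam G w))
      + 1 / (4 * (\<beta> * step1 G)) * (r \<bullet> (Hmat G *\<^sub>v r))"
    by (rule young_inequality_psd[OF c(1,7) Hmat_psd[OF G] r d]) (use \<beta> h in auto)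
  also have "\<beta> * step1 G * (dw_Gam G w \<bullet> (Hmat G *\<^sub>v dw_Gam G w)) \<le> S"
    unfolding S_def using fd_stiffness_bound[OF G _ \<beta> w] b by (auto simp: borrowing_capacity_def)
  also have "1 / (4 * (\<beta> * step1 G)) * (r \<bullet> (Hmat G *\<^sub>v r)) \<le> tau_w \<pi> / step1 G * (r \<bullet> (Hmat G *\<^sub>v r))"
  proof (rule mult_right_mono)
    have "1 / (4 * (\<beta> * step1 G)) = 1 / (4 * \<beta>) / step1 G" by simp
    also have "\<dots> \<le> tau_w \<pi> / step1 G" using \<tau> h by (intro divide_right_mono) auto
    finally show "1 / (4 * (\<beta> * step1 G)) \<le> tau_w \<pi> / step1 G" .
  qed (rule Hmat_psd[OF G r])
  finally have "0 \<le> b1 \<pi> * (S + tau_w \<pi> / step1 G * (r \<bullet> (Hmat G *\<^sub>v r)) - dw_Gam G w \<bullet> (Hmat G *\<^sub>v r))"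
    using b1 by simp
  then show ?thesis
    by (simp add: E1_def Let_def r_def[symmetric] S_def[symmetric] algebra_simps)
qed

text \<open>The same argument with the parameter \<open>C h\<^sub>2\<close> from the trace inequality. The weight
\<open>1 / (4 C h\<^sub>2)\<close> that remains for the squared jump is dominated by the penalty.\<close>

lemma E2_nonpos:
  assumes R: "dg_discretization q R" and C: "C > 0" "discrete_trace_ineq q R C" and \<tau>: "tau_u \<pi> \<ge> 1 / C"
    and b2: "b2 \<pi> > 0" and P: "Pg_wu P \<in> carrier_mat (ndof q R) (npts G)" and G: "sbp_operator G"
    and w: "w \<in> carrier_vec (npts G * npts G)" and u: "u \<in> DG_space q (elems R)"
  shows "E2 \<pi> q G R P w u \<le> 0"
proof -
  define s where "s = u_Gam q R u - Pg_wu P *\<^sub>v w_Gam G w"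
  define y where "y = uy_Gam q R u"
  let ?M = "Mmat q R" and ?h = "mesh_size R"
  have s: "s \<in> carrier_vec (ndof q R)"
    using mult_mat_vec_carrier[OF P interface_carriers(1)[OF G w]] u_Gam_carrier(1) by (simp add: s_def)
  have y: "y \<in> carrier_vec (ndof q R)" unfolding y_def by (rule u_Gam_carrier)
  have h: "?h > 0" by (rule mesh_size_pos[OF R])
  have "s \<bullet> (?M *\<^sub>v y) \<le> C * ?h * (y \<bullet> (?M *\<^sub>v y)) + 1 / (4 * (C * ?h)) * (s \<bullet> (?M *\<^sub>v s))"
    by (rule young_inequality_psd[OF Mmat_carrier Mmat_symmetric Mmat_psd[OF R] s y]) (use C h in auto)
  also have "C * ?h * (y \<bullet> (?M *\<^sub>v y)) \<le> dg_grad_inner R u u"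
  proof -
    have "y \<bullet> (?M *\<^sub>v y) = (\<Sum>k<nfaces R. face_inner R k (normal_deriv R u k) (normal_deriv R u k))"
      by (simp add: y_def sum_face_inner_eq_Mmat[OF R u_Gam_carrier(2) u_Gam_carrier(2), symmetric]
          traces_eq_face_fun[OF R _ u] cong: sum.cong_simp)
    then show ?thesis using C(2) u by (simp add: discrete_trace_ineq_def)
  qed
  also have "1 / (4 * (C * ?h)) * (s \<bullet> (?M *\<^sub>v s)) \<le> tau_u \<pi> / ?h * (s \<bullet> (?M *\<^sub>v s))"
  proof (rule mult_right_mono)
    have "1 / (4 * (C * ?h)) = (1 / 4) * (1 / C) / ?h" by simp
    also have "\<dots> \<le> 1 / C / ?h" using C h by (intro divide_right_mono) (auto simp: field_simps)
    also have "\<dots> \<le> tau_u \<pi> / ?h" using \<tau> h by (intro divide_right_mono) auto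
    finally show "1 / (4 * (C * ?h)) \<le> tau_u \<pi> / ?h" .
  qed (rule Mmat_psd[OF R s])
  finally have "0 \<le> b2 \<pi> * (dg_grad_inner R u u + tau_u \<pi> / ?h * (s \<bullet> (?M *\<^sub>v s)) - s \<bullet> (?M *\<^sub>v y))"
    using b2 by simp
  then show ?thesis
    by (simp add: E2_def Let_def s_def[symmetric] y_def[symmetric] algebra_simps)
qed

section \<open>Time derivatives of the volume terms\<close>

text \<open>The linear map \<open>L\<close> stands for the identity and for the gradient. By its expansion, the integral is a quadratic
form in the values at the lattice points with coefficients independent of time, and the
product rule applies to these values.\<close>

lemma dg_quadratic_time_deriv:
  fixes F :: "nat \<times> nat \<Rightarrow> point \<Rightarrow> 'b::real_inner"
  assumes R: "dg_discretization q R" and u: "dg_time_deriv T q R u u'" and t: "t \<in> {0<..T}"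
    and L: "\<And>p z. p \<in> polys q \<Longrightarrow> L p z = (\<Sum>i\<in>{..q}\<times>{..q}. p (lattice_pt i) *\<^sub>R F i z)"
    and F: "\<And>S i. continuous_on S (F i)"
  shows "((\<lambda>s. \<Sum>K\<in>elems R. LINT z:K|lborel. inner (L (u s K) z) (L (u s K) z))
    has_real_derivative 2 * (\<Sum>K\<in>elems R. LINT z:K|lborel. inner (L (u t K) z) (L (u' t K) z)))
      (at t within {0<..T})"
proof -
  let ?I = "{..q}\<times>{..q}"
  have poly: "u s K \<in> polys q" "u' s K \<in> polys q" if "K \<in> elems R" "s \<in> {0<..T}" for K s
    using u that by (auto simp: dg_time_deriv_def DG_space_def)
  define m where "m K i j = (LINT z:K|lborel. inner (F i z) (F j z))" for K i j
  have m_sym: "m K i j = m K j i" for K i j by (simp add: m_def inner_commute)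
  have expand: "(LINT z:K|lborel. inner (L p z) (L p' z)) = (\<Sum>i\<in>?I. \<Sum>j\<in>?I. p (lattice_pt i) * p' (lattice_pt j) * m K i j)"
    if "K \<in> elems R" "p \<in> polys q" "p' \<in> polys q" for K p p'
    unfolding L[OF that(2)] L[OF that(3)] m_def
    by (rule integral_inner_sums[OF elem_compact[OF R that(1)] _ F]) auto
  have du: "((\<lambda>s. u s K z) has_real_derivative u' t K z) (at t within {0<..T})" if "K \<in> elems R" for K z
    using u t that unfolding dg_time_deriv_def by blast
  have "((\<lambda>s. \<Sum>K\<in>elems R. \<Sum>i\<in>?I. \<Sum>j\<in>?I. u s K (lattice_pt i) * u s K (lattice_pt j) * m K i j)
    has_real_derivative (\<Sum>K\<in>elems R. \<Sum>i\<in>?I. \<Sum>j\<in>?I.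
        (u t K (lattice_pt i) * u' t K (lattice_pt j) + u' t K (lattice_pt i) * u t K (lattice_pt j)) * m K i j))
      (at t within {0<..T})"
    by (intro DERIV_sum DERIV_cmult_right DERIV_mult' du)
  also have "(\<Sum>K\<in>elems R. \<Sum>i\<in>?I. \<Sum>j\<in>?I.
        (u t K (lattice_pt i) * u' t K (lattice_pt j) + u' t K (lattice_pt i) * u t K (lattice_pt j)) * m K i j)
    = (\<Sum>K\<in>elems R. 2 * (\<Sum>i\<in>?I. \<Sum>j\<in>?I. u t K (lattice_pt i) * u' t K (lattice_pt j) * m K i j))"
  proof (rule sum.cong[OF refl])
    fix K
    \<comment> \<open>Both terms of the product rule coincide by symmetry of \<open>m\<close>.\<close>
    have "(\<Sum>i\<in>?I. \<Sum>j\<in>?I. u' t K (lattice_pt i) * u t K (lattice_pt j) * m K i j)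
      = (\<Sum>j\<in>?I. \<Sum>i\<in>?I. u' t K (lattice_pt i) * u t K (lattice_pt j) * m K i j)"
      by (rule sum.swap)
    also have "\<dots> = (\<Sum>i\<in>?I. \<Sum>j\<in>?I. u t K (lattice_pt i) * u' t K (lattice_pt j) * m K i j)"
      by (intro sum.cong refl) (simp add: m_sym mult.commute)
    finally show "(\<Sum>i\<in>?I. \<Sum>j\<in>?I.
        (u t K (lattice_pt i) * u' t K (lattice_pt j) + u' t K (lattice_pt i) * u t K (lattice_pt j)) * m K i j)
     = 2 * (\<Sum>i\<in>?I. \<Sum>j\<in>?I. u t K (lattice_pt i) * u' t K (lattice_pt j) * m K i j)"
      by (simp add: distrib_right sum.distrib)
  qed
  also have "\<dots> = 2 * (\<Sum>K\<in>elems R. LINT z:K|lborel. inner (L (u t K) z) (L (u' t K) z))"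
    by (simp add: expand[OF _ poly(1)[OF _ t] poly(2)[OF _ t]] sum_distrib_left cong: sum.cong_simp)
  finally show ?thesis
    unfolding has_field_derivative_def
    by (rule has_derivative_transform[OF t, rotated]) (intro sum.cong refl expand poly; assumption)
qed

lemma dg_inner_time_deriv:
  assumes "dg_discretization q R" "dg_time_deriv T q R u u'" "t \<in> {0<..T}"
  shows "((\<lambda>s. dg_inner R (u s) (u s)) has_real_derivative 2 * dg_inner R (u' t) (u t)) (at t within {0<..T})"
  using dg_quadratic_time_deriv[OF assms, of "\<lambda>p. p" "tensor_lagrange q"]
  by (simp add: dg_inner_def polys_tensor_expansion continuous_tensor_lagrange mult.commute)

lemma dg_grad_inner_time_deriv:
  assumes "dg_discretization q R" "dg_time_deriv T q R u u'" "t \<in> {0<..T}"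
  shows "((\<lambda>s. dg_grad_inner R (u s) (u s)) has_real_derivative 2 * dg_grad_inner R (u t) (u' t)) (at t within {0<..T})"
  using dg_quadratic_time_deriv[OF assms, of grad "tensor_lagrange_grad q"]
  by (simp add: dg_grad_inner_def grad_tensor_expansion continuous_tensor_lagrange)

section \<open>Time derivatives of grid functions and interface data\<close>

text \<open>Carriers and membership in the Galerkin space are known only for times in the interval, so derivatives have to
be transferred between functions that agree only there.\<close>

lemma has_real_derivative_transform:
  fixes f g :: "real \<Rightarrow> real"
  assumes "t \<in> S" "\<And>s. s \<in> S \<Longrightarrow> g s = f s" "(f has_real_derivative D) (at t within S)"
  shows "(g has_real_derivative D) (at t within S)"
  using assms unfolding has_field_derivative_def by (rule has_derivative_transform)

lemma vec_time_derivD: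
  assumes "vec_time_deriv T n x x'" "t \<in> {0<..T}"
  shows "x t \<in> carrier_vec n" "x' t \<in> carrier_vec n"
    "\<And>i. i < n \<Longrightarrow> ((\<lambda>s. x s $ i) has_real_derivative x' t $ i) (at t within {0<..T})"
  using assms by (auto simp: vec_time_deriv_def)

lemma vec_time_deriv_diff:
  assumes x: "vec_time_deriv T n x x'" and y: "vec_time_deriv T n y y'"
  shows "vec_time_deriv T n (\<lambda>t. x t - y t) (\<lambda>t. x' t - y' t)"
  unfolding vec_time_deriv_def
proof (intro ballI conjI allI impI)
  fix t assume t: "t \<in> {0<..T}"
  note xt = vec_time_derivD[OF x] and yt = vec_time_derivD[OF y]
  show "x t - y t \<in> carrier_vec n" "x' t - y' t \<in> carrier_vec n"
    using xt(1,2)[OF t] yt(1,2)[OF t] by auto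
  fix i assume i: "i < n"
  have "((\<lambda>s. x s $ i - y s $ i) has_real_derivative x' t $ i - y' t $ i) (at t within {0<..T})"
    by (intro DERIV_diff xt(3) yt(3) t i)
  moreover have "(x s - y s) $ i = x s $ i - y s $ i" if "s \<in> {0<..T}" for s
    using xt(1)[OF that] yt(1)[OF that] i by simp
  moreover have "(x' t - y' t) $ i = x' t $ i - y' t $ i"
    using xt(2)[OF t] yt(2)[OF t] i by simp
  ultimately show "((\<lambda>s. (x s - y s) $ i) has_real_derivative (x' t - y' t) $ i) (at t within {0<..T})"
    unfolding has_field_derivative_def by (auto intro: has_derivative_transform[OF t])
qed

lemma scalar_prod_time_deriv:
  assumes x: "vec_time_deriv T n x x'" and y: "vec_time_deriv T n y y'" and t: "t \<in> {0<..T}"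
  shows "((\<lambda>s. x s \<bullet> y s) has_real_derivative x' t \<bullet> y t + x t \<bullet> y' t) (at t within {0<..T})"
proof -
  note xt = vec_time_derivD[OF x] and yt = vec_time_derivD[OF y]
  have "((\<lambda>s. \<Sum>i<n. x s $ i * y s $ i) has_real_derivative (\<Sum>i<n. x t $ i * y' t $ i + x' t $ i * y t $ i))
      (at t within {0<..T})"
    by (intro DERIV_sum DERIV_mult' xt(3) yt(3) t) auto
  moreover have "x s \<bullet> y s = (\<Sum>i<n. x s $ i * y s $ i)" if "s \<in> {0<..T}" for s
    using yt(1)[OF that] by (simp add: scalar_prod_def lessThan_atLeast0)
  moreover have "x' t \<bullet> y t + x t \<bullet> y' t = (\<Sum>i<n. x t $ i * y' t $ i + x' t $ i * y t $ i)"
    using yt(1,2)[OF t] by (simp add: scalar_prod_def lessThan_atLeast0 sum.distrib)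
  ultimately show ?thesis
    unfolding has_field_derivative_def by (auto intro: has_derivative_transform[OF t])
qed

lemma vec_time_deriv_mult_mat:
  assumes x: "vec_time_deriv T n x x'" and A: "A \<in> carrier_mat m n"
  shows "vec_time_deriv T m (\<lambda>t. A *\<^sub>v x t) (\<lambda>t. A *\<^sub>v x' t)"
  unfolding vec_time_deriv_def
proof (intro ballI conjI allI impI)
  fix t assume t: "t \<in> {0<..T}"
  note xt = vec_time_derivD[OF x]
  show "A *\<^sub>v x t \<in> carrier_vec m" "A *\<^sub>v x' t \<in> carrier_vec m"
    using mult_mat_vec_carrier[OF A] xt(1,2)[OF t] by auto
  fix i assume i: "i < m"
  have row: "Matrix.row A i \<in> carrier_vec n" using A i by auto
  \<comment> \<open>An entry of the product is the scalar product with a constant row.\<close>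
  have "vec_time_deriv T n (\<lambda>_. Matrix.row A i) (\<lambda>_. 0\<^sub>v n)"
    using row by (auto simp: vec_time_deriv_def)
  from scalar_prod_time_deriv[OF this x t]
  show "((\<lambda>s. (A *\<^sub>v x s) $ i) has_real_derivative (A *\<^sub>v x' t) $ i) (at t within {0<..T})"
    using xt(1)[OF t] A i by simp
qed

lemma bilinear_form_time_deriv:
  assumes "vec_time_deriv T n x x'" "vec_time_deriv T m y y'" "A \<in> carrier_mat n m" "t \<in> {0<..T}"
  shows "((\<lambda>s. x s \<bullet> (A *\<^sub>v y s)) has_real_derivative x' t \<bullet> (A *\<^sub>v y t) + x t \<bullet> (A *\<^sub>v y' t))
    (at t within {0<..T})"
  by (rule scalar_prod_time_deriv[OF assms(1) vec_time_deriv_mult_mat[OF assms(2,3)] assms(4)])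

lemma interface_time_derivs:
  assumes G: "sbp_operator G" and w: "vec_time_deriv T (npts G * npts G) w w'"
  shows "vec_time_deriv T (npts G) (\<lambda>t. w_Gam G (w t)) (\<lambda>t. w_Gam G (w' t))"
    "vec_time_deriv T (npts G) (\<lambda>t. dw_Gam G (w t)) (\<lambda>t. dw_Gam G (w' t))"
  unfolding w_Gam_def dw_Gam_def
  by (rule vec_time_deriv_mult_mat[OF w]; use Gam_carriers[OF G] in simp)+

text \<open>The trace consists of point values. The normal derivative is a fixed linear combination of point
values at the lattice points, which is why its time derivative is the normal derivative of the time derivative.\<close>

lemma trace_time_derivs:
  assumes R: "dg_discretization q R" and u: "dg_time_deriv T q R u u'"
  shows "vec_time_deriv T (ndof q R) (\<lambda>t. u_Gam q R (u t)) (\<lambda>t. u_Gam q R (u' t))"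
    "vec_time_deriv T (ndof q R) (\<lambda>t. uy_Gam q R (u t)) (\<lambda>t. uy_Gam q R (u' t))"
proof -
  have du: "((\<lambda>s. u s K z) has_real_derivative u' t K z) (at t within {0<..T})"
    if "K \<in> elems R" "t \<in> {0<..T}" for K z t
    using u that unfolding dg_time_deriv_def by blast
  have face: "faces R ! (a div (q + 1)) \<in> elems R" if "a < ndof q R" for a
    using faces_in_elems[OF R div_mod_less(1)] that by (simp add: ndof_def)
  have nd: "normal_deriv R v k x = (\<Sum>i\<in>{..q}\<times>{..q}. v (faces R ! k) (lattice_pt i) * inner (tensor_lagrange_grad q i (x, 0)) (0, 1))"
    if "v \<in> DG_space q (elems R)" "faces R ! k \<in> elems R" for v k x
    using that by (auto simp: normal_deriv_def DG_space_def grad_tensor_expansion inner_sum_left)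
  have poly: "u t \<in> DG_space q (elems R)" "u' t \<in> DG_space q (elems R)" if "t \<in> {0<..T}" for t
    using u that by (auto simp: dg_time_deriv_def)
  show "vec_time_deriv T (ndof q R) (\<lambda>t. u_Gam q R (u t)) (\<lambda>t. u_Gam q R (u' t))"
    unfolding vec_time_deriv_def u_Gam_def lagrange_coeffs_def trace_def
    using du face by auto
  show "vec_time_deriv T (ndof q R) (\<lambda>t. uy_Gam q R (u t)) (\<lambda>t. uy_Gam q R (u' t))"
    unfolding vec_time_deriv_def
  proof (intro ballI conjI allI impI u_Gam_carrier)
    fix t a assume t: "t \<in> {0<..T}" and a: "a < ndof q R"
    let ?k = "a div (q + 1)" and ?x = "nodes R (a div (q + 1)) (a mod (q + 1))"
    let ?c = "\<lambda>i. inner (tensor_lagrange_grad q i (?x, 0)) (0, 1)"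
    have sum_deriv: "((\<lambda>s. \<Sum>i\<in>{..q}\<times>{..q}. u s (faces R ! ?k) (lattice_pt i) * ?c i) has_real_derivative
      (\<Sum>i\<in>{..q}\<times>{..q}. u' t (faces R ! ?k) (lattice_pt i) * ?c i)) (at t within {0<..T})"
      by (intro DERIV_sum DERIV_cmult_right du face a t)
    have "uy_Gam q R v $ a = (\<Sum>i\<in>{..q}\<times>{..q}. v (faces R ! ?k) (lattice_pt i) * ?c i)"
      if "v \<in> DG_space q (elems R)" for v
      unfolding uy_Gam_def lagrange_coeffs_def index_vec[OF a] by (rule nd[OF that face[OF a]])
    note uy = this
    show "((\<lambda>s. uy_Gam q R (u s) $ a) has_real_derivative uy_Gam q R (u' t) $ a) (at t within {0<..T})"
      unfolding uy[OF poly(2)[OF t]]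
      by (rule has_real_derivative_transform[OF t uy[OF poly(1)] sum_deriv])
  qed
qed

section \<open>Conservation of energy\<close>

text \<open>Norm compatibility says that each \<open>g\<close> projection is adjoint to the \<open>b\<close> projection in the opposite
direction, with respect to \<open>H\<close> on the grid and \<open>M\<close> on the mesh.\<close>

lemma norm_compatible_forms:
  assumes G: "sbp_operator G" and P: "norm_compatible q G R P"
    and x: "x \<in> carrier_vec (npts G)" and y: "y \<in> carrier_vec (ndof q R)"
  shows "x \<bullet> (Hmat G *\<^sub>v (Pg_uw P *\<^sub>v y)) = y \<bullet> (Mmat q R *\<^sub>v (Pb_wu P *\<^sub>v x))"
    "x \<bullet> (Hmat G *\<^sub>v (Pb_uw P *\<^sub>v y)) = y \<bullet> (Mmat q R *\<^sub>v (Pg_wu P *\<^sub>v x))"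
proof -
  have *: "x \<bullet> (Hmat G *\<^sub>v (A *\<^sub>v y)) = y \<bullet> (Mmat q R *\<^sub>v (B *\<^sub>v x))"
    if A: "A \<in> carrier_mat (npts G) (ndof q R)" and B: "B \<in> carrier_mat (ndof q R) (npts G)"
      and eq: "Hmat G * A = transpose_mat (Mmat q R * B)" for A B
  proof -
    have MB: "Mmat q R * B \<in> carrier_mat (ndof q R) (npts G)" by (rule mult_carrier_mat[OF Mmat_carrier B])
    have "Hmat G *\<^sub>v (A *\<^sub>v y) = transpose_mat (Mmat q R * B) *\<^sub>v y"
      using assoc_mult_mat_vec[OF sbp_carriers(1)[OF G] A y] eq by simp
    also have "x \<bullet> \<dots> = y \<bullet> ((Mmat q R * B) *\<^sub>v x)"
      using scalar_prod_transpose_swap[OF MB y x] by simp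
    also have "(Mmat q R * B) *\<^sub>v x = Mmat q R *\<^sub>v (B *\<^sub>v x)"
      by (rule assoc_mult_mat_vec[OF Mmat_carrier B x])
    finally show ?thesis .
  qed
  show "x \<bullet> (Hmat G *\<^sub>v (Pg_uw P *\<^sub>v y)) = y \<bullet> (Mmat q R *\<^sub>v (Pb_wu P *\<^sub>v x))"
    "x \<bullet> (Hmat G *\<^sub>v (Pb_uw P *\<^sub>v y)) = y \<bullet> (Mmat q R *\<^sub>v (Pg_wu P *\<^sub>v x))"
    using P by (auto simp: norm_compatible_def intro!: *)
qed

lemma stiffness_carrier:
  assumes "sbp_operator G"
  shows "Amat G \<otimes>\<^sub>k Hmat G + Hmat G \<otimes>\<^sub>k Amat G \<in> carrier_mat (npts G * npts G) (npts G * npts G)"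
    "transpose_mat (Amat G \<otimes>\<^sub>k Hmat G + Hmat G \<otimes>\<^sub>k Amat G) = Amat G \<otimes>\<^sub>k Hmat G + Hmat G \<otimes>\<^sub>k Amat G"
    "transpose_mat (H2 G) = H2 G"
proof -
  note c = sbp_carriers[OF assms]
  note k = kron_carrier[OF c(1,2)] kron_carrier[OF c(2,1)]
  show "Amat G \<otimes>\<^sub>k Hmat G + Hmat G \<otimes>\<^sub>k Amat G \<in> carrier_mat (npts G * npts G) (npts G * npts G)"
    by (rule add_carrier_mat[OF k(1)])
  show "transpose_mat (Amat G \<otimes>\<^sub>k Hmat G + Hmat G \<otimes>\<^sub>k Amat G) = Amat G \<otimes>\<^sub>k Hmat G + Hmat G \<otimes>\<^sub>k Amat G"
    by (subst transpose_add[OF k(2,1)]) (simp add: transpose_kron c)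
  show "transpose_mat (H2 G) = H2 G" by (simp add: H2_def transpose_kron c)
qed

text \<open>Testing the finite difference scheme with \<open>x\<close>. The transposes of \<open>e_Gam\<close> and \<open>d_Gam\<close> move to \<open>x\<close> and give its
interface value and normal derivative. The scheme contains \<open>- s\<close>, hence the sign of the last term.\<close>

lemma H2_form_fd_rhs:
  fixes u :: dgfun
  assumes G: "sbp_operator G" and P: "norm_compatible q G R P"
    and w: "w \<in> carrier_vec (npts G * npts G)" and x: "x \<in> carrier_vec (npts G * npts G)"
  defines "r \<equiv> w_Gam G w - Pg_uw P *\<^sub>v u_Gam q R u"
    and "s \<equiv> u_Gam q R u - Pg_wu P *\<^sub>v w_Gam G w"
  shows "x \<bullet> (H2 G *\<^sub>v fd_rhs \<pi> q G R P w u) =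
     b1 \<pi> * (w_Gam G x \<bullet> (Hmat G *\<^sub>v dw_Gam G w) - x \<bullet> ((Amat G \<otimes>\<^sub>k Hmat G + Hmat G \<otimes>\<^sub>k Amat G) *\<^sub>v w))
     + 1/2 * b1 \<pi> * (dw_Gam G x \<bullet> (Hmat G *\<^sub>v r))
     - 1/2 * (b1 \<pi> * (w_Gam G x \<bullet> (Hmat G *\<^sub>v dw_Gam G w))
        + b2 \<pi> * (w_Gam G x \<bullet> (Hmat G *\<^sub>v (Pb_uw P *\<^sub>v uy_Gam q R u))))
     - b1 \<pi> * tau_w \<pi> / step1 G * (w_Gam G x \<bullet> (Hmat G *\<^sub>v r))
     + b2 \<pi> * sigma_w \<pi> / mesh_size R * (w_Gam G x \<bullet> (Hmat G *\<^sub>v (Pb_uw P *\<^sub>v s)))"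
proof -
  define n where "n = npts G"
  define N where "N = n * n"
  define S where "S = Amat G \<otimes>\<^sub>k Hmat G + Hmat G \<otimes>\<^sub>k Amat G"
  have Pc: "Pg_uw P \<in> carrier_mat n (ndof q R)" "Pg_wu P \<in> carrier_mat (ndof q R) n"
      "Pb_uw P \<in> carrier_mat n (ndof q R)"
    using P by (auto simp: norm_compatible_def n_def)
  note H = sbp_carriers(1)[OF G, folded n_def]
  note e = Gam_carriers[OF G, folded n_def, folded N_def]
  note S = stiffness_carrier(1)[OF G, folded S_def n_def, folded N_def]
  note h = minv_H2[OF G, folded n_def, folded N_def]
  note w = w[folded n_def, folded N_def] and x = x[folded n_def, folded N_def]
  have wc: "w_Gam G w \<in> carrier_vec n" "dw_Gam G w \<in> carrier_vec n"
    using interface_carriers[OF G, folded n_def, folded N_def, OF w] .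
  have xc: "w_Gam G x \<in> carrier_vec n" "dw_Gam G x \<in> carrier_vec n"
    using interface_carriers[OF G, folded n_def, folded N_def, OF x] .
  note uc = u_Gam_carrier[of q R u]
  have r: "r \<in> carrier_vec n" using wc mult_mat_vec_carrier[OF Pc(1) uc(1)] by (simp add: r_def)
  have s: "s \<in> carrier_vec (ndof q R)" using uc mult_mat_vec_carrier[OF Pc(2) wc(1)] by (simp add: s_def)
  have sneg: "Pg_wu P *\<^sub>v w_Gam G w - u_Gam q R u = - s"
    by (intro eq_vecI) (auto simp: s_def carrier_matD[OF Pc(2)] carrier_vecD[OF uc(1)])
  define X where "X = (1/2 * b1 \<pi>) \<cdot>\<^sub>v (d_Gam G *\<^sub>v (Hmat G *\<^sub>v r))
            - (1/2) \<cdot>\<^sub>v (e_Gam G *\<^sub>v (Hmat G *\<^sub>v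
                 (b1 \<pi> \<cdot>\<^sub>v dw_Gam G w + Pb_uw P *\<^sub>v (b2 \<pi> \<cdot>\<^sub>v uy_Gam q R u))))"
  define Y where "Y = (b1 \<pi> * tau_w \<pi> / step1 G) \<cdot>\<^sub>v (e_Gam G *\<^sub>v (Hmat G *\<^sub>v r))
            + (b2 \<pi> * sigma_w \<pi> / mesh_size R) \<cdot>\<^sub>v
                (e_Gam G *\<^sub>v (Hmat G *\<^sub>v (Pb_uw P *\<^sub>v (- s))))"
  have dims: "dim_vec r = n" "dim_vec s = ndof q R" "dim_vec (w_Gam G x) = n" "dim_vec (dw_Gam G x) = n"
     "dim_vec (w_Gam G w) = n" "dim_vec (dw_Gam G w) = n" "dim_vec x = N" "dim_vec w = N"
     "dim_vec (uy_Gam q R u) = ndof q R"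
     "dim_row (e_Gam G) = N" "dim_col (e_Gam G) = n" "dim_row (d_Gam G) = N" "dim_col (d_Gam G) = n"
     "dim_row (Hmat G) = n" "dim_col (Hmat G) = n" "dim_row (Pb_uw P) = n" "dim_col (Pb_uw P) = ndof q R"
     "dim_row (H2 G) = N" "dim_col (H2 G) = N" "dim_row (minv (H2 G)) = N" "dim_col (minv (H2 G)) = N"
     "dim_row S = N" "dim_col S = N"
    using r s wc xc x w uc e H Pc h S by (blast dest: carrier_matD carrier_vecD)+
  have X: "X \<in> carrier_vec N" and Y: "Y \<in> carrier_vec N"
    by (rule carrier_vecI; simp add: X_def Y_def dims)+
  have D2i: "D2_inner G \<in> carrier_mat N N"
    using kron_carrier[OF sbp_carriers(1)[OF G] outer_prod_carrier[OF sbp_carriers(6,4)[OF G]]] h(2)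
    by (auto simp: D2_inner_def outer_terms_def N_def n_def intro!: carrier_matI dest: carrier_matD)
  have cancel: "H2 G *\<^sub>v (minv (H2 G) *\<^sub>v z) = z" if "z \<in> carrier_vec N" for z
    using assoc_mult_mat_vec[OF h(1,2) that] h(3) that by simp
  have e_adj: "x \<bullet> (e_Gam G *\<^sub>v z) = w_Gam G x \<bullet> z" "x \<bullet> (d_Gam G *\<^sub>v z) = dw_Gam G x \<bullet> z"
    if "z \<in> carrier_vec n" for z
    using transpose_vec_mult_scalar[OF e(1) that x] transpose_vec_mult_scalar[OF e(2) that x]
    by (simp_all add: w_Gam_def dw_Gam_def)
  have D: "H2 G *\<^sub>v (D2_inner G *\<^sub>v w) = e_Gam G *\<^sub>v (Hmat G *\<^sub>v dw_Gam G w) - S *\<^sub>v w"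
  proof -
    have dT: "transpose_mat (d_Gam G) \<in> carrier_mat n N" using e(2) by simp
    have eH: "e_Gam G * Hmat G \<in> carrier_mat N n" by (rule mult_carrier_mat[OF e(1) H])
    have "H2 G *\<^sub>v (D2_inner G *\<^sub>v w) = (H2 G * D2_inner G) *\<^sub>v w"
      using assoc_mult_mat_vec[OF h(1) D2i w] by simp
    also have "\<dots> = (e_Gam G * Hmat G * transpose_mat (d_Gam G)) *\<^sub>v w - S *\<^sub>v w"
      unfolding H2_mult_D2_inner[OF G] S_def[symmetric]
      by (rule minus_mult_distrib_mat_vec[OF mult_carrier_mat[OF eH dT] S w])
    also have "(e_Gam G * Hmat G * transpose_mat (d_Gam G)) *\<^sub>v w = e_Gam G *\<^sub>v (Hmat G *\<^sub>v dw_Gam G w)"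
      using assoc_mult_mat_vec[OF eH dT w] assoc_mult_mat_vec[OF e(1) H wc(2)] by (simp add: dw_Gam_def)
    finally show ?thesis .
  qed
  have "fd_rhs \<pi> q G R P w u = b1 \<pi> \<cdot>\<^sub>v (D2_inner G *\<^sub>v w) + minv (H2 G) *\<^sub>v X - minv (H2 G) *\<^sub>v Y"
    unfolding fd_rhs_def Let_def r_def[symmetric] sneg X_def Y_def ..
  then have "H2 G *\<^sub>v fd_rhs \<pi> q G R P w u = b1 \<pi> \<cdot>\<^sub>v (H2 G *\<^sub>v (D2_inner G *\<^sub>v w)) + X - Y"
    using carrier_matD[OF D2i] by (simp add: mat_vec_add mat_vec_diff mat_vec_smult cancel[OF X] cancel[OF Y] dims)
  then have "x \<bullet> (H2 G *\<^sub>v fd_rhs \<pi> q G R P w u) =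
     x \<bullet> (b1 \<pi> \<cdot>\<^sub>v (e_Gam G *\<^sub>v (Hmat G *\<^sub>v dw_Gam G w) - S *\<^sub>v w) + X - Y)"
    by (simp only: D)
  also have "\<dots> = b1 \<pi> * (x \<bullet> (e_Gam G *\<^sub>v (Hmat G *\<^sub>v dw_Gam G w)) - x \<bullet> (S *\<^sub>v w))
     + x \<bullet> X - x \<bullet> Y"
    by (simp add: scalar_prod_add_right scalar_prod_diff_right scalar_prod_smult_right carrier_vecD[OF X] carrier_vecD[OF Y] dims)
  also have "x \<bullet> X = 1/2 * b1 \<pi> * (dw_Gam G x \<bullet> (Hmat G *\<^sub>v r))
     - 1/2 * (b1 \<pi> * (w_Gam G x \<bullet> (Hmat G *\<^sub>v dw_Gam G w))
        + b2 \<pi> * (w_Gam G x \<bullet> (Hmat G *\<^sub>v (Pb_uw P *\<^sub>v uy_Gam q R u))))"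
    by (simp add: X_def bilinear_expand e_adj carrier_vecI dims)
  also have "x \<bullet> Y = b1 \<pi> * tau_w \<pi> / step1 G * (w_Gam G x \<bullet> (Hmat G *\<^sub>v r))
     - b2 \<pi> * sigma_w \<pi> / mesh_size R * (w_Gam G x \<bullet> (Hmat G *\<^sub>v (Pb_uw P *\<^sub>v s)))"
    by (simp add: Y_def bilinear_expand mat_vec_uminus e_adj carrier_vecI dims)
  finally show ?thesis
    using e_adj(1)[OF mult_mat_vec_carrier[OF H wc(2)]] by (simp add: S_def)
qed

text \<open>The volume terms cancel by symmetry. The terms with \<open>d_Gam\<^sup>T w'\<close> and with the normal derivative of \<open>u'\<close>
cancel within each side. The remaining interface terms contain \<open>w'\<close> and \<open>u'\<close> only through their values on
the interface. Adjointness moves every projection off these values onto the other factor; after that they cancel in pairs, the penalties because the parameters agree.\<close>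

lemma energy_conserved:
  assumes G: "sbp_operator G" and R: "dg_discretization q R" and P: "norm_compatible q G R P"
    and tw: "tau_w \<pi> = sigma_u \<pi>" and tu: "tau_u \<pi> = sigma_w \<pi>"
    and sol: "semidiscrete_solution T \<pi> q G R P w w' u u'" and t: "t \<in> {0<..T}"
  shows "((\<lambda>s. energy \<pi> q G R P (w s) (w' s) (u s) (u' s)) has_real_derivative 0) (at t within {0<..T})"
proof -
  obtain w'' u'' where w: "vec_time_deriv T (npts G * npts G) w w'" and u: "dg_time_deriv T q R u u'"
    and w': "vec_time_deriv T (npts G * npts G) w' w''" and u': "dg_time_deriv T q R u' u''"
    and fd: "w'' t = fd_rhs \<pi> q G R P (w t) (u t)"
    and dg: "\<And>\<phi>. \<phi> \<in> DG_space q (elems R) \<Longrightarrow> dg_inner R (u'' t) \<phi> = dg_rhs \<pi> q G R P (w t) (u t) \<phi>"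
    using sol t unfolding semidiscrete_solution_def by blast
  define S where "S = Amat G \<otimes>\<^sub>k Hmat G + Hmat G \<otimes>\<^sub>k Amat G"
  note S = stiffness_carrier[OF G, folded S_def]
  note Hc = sbp_carriers(1)[OF G] and Hs = sbp_carriers(7)[OF G]
  note Mc = Mmat_carrier[of q R] and Ms = Mmat_symmetric[of q R]
  have Pc: "Pg_uw P \<in> carrier_mat (npts G) (ndof q R)" "Pg_wu P \<in> carrier_mat (ndof q R) (npts G)"
      "Pb_uw P \<in> carrier_mat (npts G) (ndof q R)" "Pb_wu P \<in> carrier_mat (ndof q R) (npts G)"
    using P by (auto simp: norm_compatible_def)
  have uD: "u t \<in> DG_space q (elems R)" "u' t \<in> DG_space q (elems R)"
    using u t by (auto simp: dg_time_deriv_def)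
  note dw = interface_time_derivs[OF G w] and du = trace_time_derivs[OF R u]
  define r where "r s = w_Gam G (w s) - Pg_uw P *\<^sub>v u_Gam q R (u s)" for s
  define r' where "r' s = w_Gam G (w' s) - Pg_uw P *\<^sub>v u_Gam q R (u' s)" for s
  define z where "z s = u_Gam q R (u s) - Pg_wu P *\<^sub>v w_Gam G (w s)" for s
  define z' where "z' s = u_Gam q R (u' s) - Pg_wu P *\<^sub>v w_Gam G (w' s)" for s
  have dr: "vec_time_deriv T (npts G) r r'"
    unfolding r_def[abs_def] r'_def[abs_def]
    by (rule vec_time_deriv_diff[OF dw(1) vec_time_deriv_mult_mat[OF du(1) Pc(1)]])
  have dz: "vec_time_deriv T (ndof q R) z z'"
    unfolding z_def[abs_def] z'_def[abs_def]
    by (rule vec_time_deriv_diff[OF du(1) vec_time_deriv_mult_mat[OF dw(1) Pc(2)]])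
  have half: "2 * (- 1 / 2 * a) = - a" for a :: real by simp
  have energy_eq: "energy \<pi> q G R P (w s) (w' s) (u s) (u' s) =
      w' s \<bullet> (H2 G *\<^sub>v w' s) + dg_inner R (u' s) (u' s)
      + (b1 \<pi> * (w s \<bullet> (S *\<^sub>v w s)) + b1 \<pi> * tau_w \<pi> / step1 G * (r s \<bullet> (Hmat G *\<^sub>v r s))
         - b1 \<pi> * (dw_Gam G (w s) \<bullet> (Hmat G *\<^sub>v r s)))
      + (b2 \<pi> * dg_grad_inner R (u s) (u s) + b2 \<pi> * tau_u \<pi> / mesh_size R * (z s \<bullet> (Mmat q R *\<^sub>v z s))
         - b2 \<pi> * (z s \<bullet> (Mmat q R *\<^sub>v uy_Gam q R (u s))))" for s
    unfolding energy_def E1_def E2_def Let_def r_def[symmetric] z_def[symmetric] S_def[symmetric]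
    by (simp only: half diff_minus_eq_add)
  define W where "W = w_Gam G (w' t)"
  define Dw where "Dw = dw_Gam G (w t)"
  define Dw' where "Dw' = dw_Gam G (w' t)"
  define U where "U = u_Gam q R (u' t)"
  define Uy where "Uy = uy_Gam q R (u t)"
  define Uy' where "Uy' = uy_Gam q R (u' t)"
  note wt = vec_time_derivD(1,2)[OF w t] vec_time_derivD(2)[OF w' t]
  have c: "W \<in> carrier_vec (npts G)" "Dw \<in> carrier_vec (npts G)" "Dw' \<in> carrier_vec (npts G)"
    "U \<in> carrier_vec (ndof q R)" "Uy \<in> carrier_vec (ndof q R)" "Uy' \<in> carrier_vec (ndof q R)"
    "r t \<in> carrier_vec (npts G)" "z t \<in> carrier_vec (ndof q R)"
    using interface_carriers[OF G wt(1)] interface_carriers[OF G wt(2)] u_Gam_carrier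
       vec_time_derivD(1)[OF dr t] vec_time_derivD(1)[OF dz t]
    by (auto simp: W_def Dw_def Dw'_def U_def Uy_def Uy'_def)
  have deriv: "((\<lambda>s. energy \<pi> q G R P (w s) (w' s) (u s) (u' s)) has_real_derivative
      (w'' t \<bullet> (H2 G *\<^sub>v w' t) + w' t \<bullet> (H2 G *\<^sub>v w'' t)) + 2 * dg_inner R (u'' t) (u' t)
      + (b1 \<pi> * (w' t \<bullet> (S *\<^sub>v w t) + w t \<bullet> (S *\<^sub>v w' t))
         + b1 \<pi> * tau_w \<pi> / step1 G * (r' t \<bullet> (Hmat G *\<^sub>v r t) + r t \<bullet> (Hmat G *\<^sub>v r' t))
         - b1 \<pi> * (Dw' \<bullet> (Hmat G *\<^sub>v r t) + Dw \<bullet> (Hmat G *\<^sub>v r' t)))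
      + (b2 \<pi> * (2 * dg_grad_inner R (u t) (u' t))
         + b2 \<pi> * tau_u \<pi> / mesh_size R * (z' t \<bullet> (Mmat q R *\<^sub>v z t) + z t \<bullet> (Mmat q R *\<^sub>v z' t))
         - b2 \<pi> * (z' t \<bullet> (Mmat q R *\<^sub>v Uy) + z t \<bullet> (Mmat q R *\<^sub>v Uy')))) (at t within {0<..T})"
    unfolding energy_eq Dw_def Dw'_def Uy_def Uy'_def
    by (intro DERIV_add DERIV_diff DERIV_cmult
        dg_inner_time_deriv[OF R u' t] dg_grad_inner_time_deriv[OF R u t]
        bilinear_form_time_deriv[OF w' w' minv_H2(1)[OF G] t] bilinear_form_time_deriv[OF w w S(1) t]
        bilinear_form_time_deriv[OF dr dr Hc t] bilinear_form_time_deriv[OF dw(2) dr Hc t]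
        bilinear_form_time_deriv[OF dz dz Mc t] bilinear_form_time_deriv[OF dz du(2) Mc t])
  have r't: "r' t = W - Pg_uw P *\<^sub>v U" and z't: "z' t = U - Pg_wu P *\<^sub>v W"
    by (simp_all add: r'_def z'_def W_def U_def)
  note PU = mult_mat_vec_carrier[OF Pc(1) c(4)] mult_mat_vec_carrier[OF Pc(2) c(1)]
    mult_mat_vec_carrier[OF Pc(4) c(2)] mult_mat_vec_carrier[OF Pc(4) c(7)]
  have r'c: "r' t \<in> carrier_vec (npts G)" "z' t \<in> carrier_vec (ndof q R)"
    using vec_time_derivD(2)[OF dr t] vec_time_derivD(2)[OF dz t] .
  note H_sym = symmetric_form_commute[OF Hc Hs] and M_sym = symmetric_form_commute[OF Mc Ms]
  note nc = norm_compatible_forms[OF G P]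
  have dims: "dim_vec W = npts G" "dim_vec U = ndof q R" "dim_vec Dw = npts G"
     "dim_vec (r t) = npts G" "dim_vec (z t) = ndof q R" "dim_vec Uy = ndof q R"
     "dim_row (Hmat G) = npts G" "dim_col (Hmat G) = npts G" "dim_row (Mmat q R) = ndof q R" "dim_col (Mmat q R) = ndof q R"
     "dim_row (Pg_uw P) = npts G" "dim_row (Pg_wu P) = ndof q R"
    using c Hc Mc Pc by (blast dest: carrier_matD carrier_vecD)+
  \<comment> \<open>Symmetry and adjointness bring all terms into a normal form in which \<open>W\<close> and \<open>U\<close> are never projected.\<close>
  have 1: "w'' t \<bullet> (H2 G *\<^sub>v w' t) = w' t \<bullet> (H2 G *\<^sub>v w'' t)"
    by (rule symmetric_form_commute[OF minv_H2(1)[OF G] S(3) wt(3,2)])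
  have 2: "w t \<bullet> (S *\<^sub>v w' t) = w' t \<bullet> (S *\<^sub>v w t)"
    by (rule symmetric_form_commute[OF S(1,2) wt(1,2)])
  have 3: "r t \<bullet> (Hmat G *\<^sub>v r' t) = r' t \<bullet> (Hmat G *\<^sub>v r t)" by (rule H_sym[OF c(7) r'c(1)])
  have 4: "r' t \<bullet> (Hmat G *\<^sub>v r t) = W \<bullet> (Hmat G *\<^sub>v r t) - U \<bullet> (Mmat q R *\<^sub>v (Pb_wu P *\<^sub>v r t))"
    using H_sym[OF PU(1) c(7)] nc(1)[OF c(7,4)] by (simp add: r't scalar_prod_diff_left dims)
  have 5: "Dw \<bullet> (Hmat G *\<^sub>v r' t) = W \<bullet> (Hmat G *\<^sub>v Dw) - U \<bullet> (Mmat q R *\<^sub>v (Pb_wu P *\<^sub>v Dw))"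
    using H_sym[OF c(2,1)] nc(1)[OF c(2,4)] by (simp add: r't mat_vec_diff scalar_prod_diff_right dims)
  have 6: "z t \<bullet> (Mmat q R *\<^sub>v z' t) = z' t \<bullet> (Mmat q R *\<^sub>v z t)" by (rule M_sym[OF c(8) r'c(2)])
  have 7: "z' t \<bullet> (Mmat q R *\<^sub>v z t) = z t \<bullet> (Mmat q R *\<^sub>v U) - W \<bullet> (Hmat G *\<^sub>v (Pb_uw P *\<^sub>v z t))"
    using M_sym[OF c(4,8)] M_sym[OF PU(2) c(8)] nc(2)[OF c(1,8)] by (simp add: z't scalar_prod_diff_left dims)
  have 8: "z' t \<bullet> (Mmat q R *\<^sub>v Uy) = Uy \<bullet> (Mmat q R *\<^sub>v U) - W \<bullet> (Hmat G *\<^sub>v (Pb_uw P *\<^sub>v Uy))"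
    using M_sym[OF c(4,5)] M_sym[OF PU(2) c(5)] nc(2)[OF c(1,5)] by (simp add: z't scalar_prod_diff_left dims)
  have 9: "(Pb_wu P *\<^sub>v Dw) \<bullet> (Mmat q R *\<^sub>v U) = U \<bullet> (Mmat q R *\<^sub>v (Pb_wu P *\<^sub>v Dw))"
     "(Pb_wu P *\<^sub>v r t) \<bullet> (Mmat q R *\<^sub>v U) = U \<bullet> (Mmat q R *\<^sub>v (Pb_wu P *\<^sub>v r t))"
    by (rule M_sym[OF PU(3) c(4)], rule M_sym[OF PU(4) c(4)])
  note fd' = H2_form_fd_rhs[OF G P wt(1,2), of \<pi> "u t", folded fd S_def W_def Dw_def Dw'_def Uy_def r_def z_def]
  note dg' = dg_rhs_eq_Mmat[OF R uD P G wt(1), of \<pi>, folded dg[OF uD(2)] Dw_def U_def Uy_def Uy'_def r_def z_def, unfolded 9]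
  show ?thesis
    by (rule DERIV_cong[OF deriv]) (simp add: 1 2 3 4 5 6 7 8 fd' dg' tw tu algebra_simps)
qed

theorem theorem4:
  fixes T \<beta> C\<^sub>t\<^sub>r :: real and q :: nat and \<pi> :: parameters
    and G :: "'i \<Rightarrow> fd_operator" and R :: "'i \<Rightarrow> dg_mesh" and P :: "'i \<Rightarrow> projections"
  assumes "T > 0" and "b1 \<pi> > 0" and "b2 \<pi> > 0" and "b1 \<pi> \<noteq> b2 \<pi>"
    and "\<And>i. sbp_operator (G i)"
    and "\<And>i. borrowing_capacity (G i) \<beta>"
    and "\<And>i. dg_discretization q (R i)"
    and "shape_regular (range (\<lambda>i. elems (R i)))"
    and "C\<^sub>t\<^sub>r > 0"
    and "\<And>i. discrete_trace_ineq q (R i) C\<^sub>t\<^sub>r"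
    and "\<And>i. norm_compatible q (G i) (R i) (P i)"
    and "tau_w \<pi> = sigma_u \<pi>" and "sigma_u \<pi> \<ge> 1 / (4 * \<beta>)"
    and "tau_u \<pi> = sigma_w \<pi>" and "sigma_w \<pi> \<ge> 1 / C\<^sub>t\<^sub>r"
  shows "\<forall>i. energy_stable T \<pi> q (G i) (R i) (P i)"
proof
  fix i
  have "Pg_uw (P i) \<in> carrier_mat (npts (G i)) (ndof q (R i))" "Pg_wu (P i) \<in> carrier_mat (ndof q (R i)) (npts (G i))"
    using assms(11)[of i] by (auto simp: norm_compatible_def)
  then have "E1 \<pi> q (G i) (R i) (P i) w u \<le> 0 \<and> E2 \<pi> q (G i) (R i) (P i) w u \<le> 0"
    if "w \<in> carrier_vec (npts (G i) * npts (G i))" "u \<in> DG_space q (elems (R i))" for w u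
    using E1_nonpos[OF assms(5,6) _ assms(2) _ that(1)] E2_nonpos[OF assms(7,9,10) _ assms(3) _ assms(5) that] assms(12-15)
    by simp
  then show "energy_stable T \<pi> q (G i) (R i) (P i)"
    unfolding energy_stable_def using energy_conserved[OF assms(5,7,11,12,14)] by blast
qed

end
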